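(* Let $X$ be a connected quandle, $a\in X$, $\widetilde X$ the extended quandle, and $p:\widetilde X\to X$, $p(g)=a\cdot g$, the universal covering, with induced homomorphism $p_*:\mathrm{As}(\widetilde X)\to\mathrm{As}(X)$, $e_g\mapsto e_{a\cdot g}$. Then $H_2^Q(\widetilde X)\cong\mathrm{Ker}(p_* )$. In particular, if $X$ is of type $t_X<\infty$, then $H_2^Q(\widetilde X)$ is annihilated by $t_X$.
   Context: A quandle is a set $X$ with a binary operation $\lhd$ such that $a\lhd a=a$, each $x\mapsto x\lhd a$ is bijective, and $(a\lhd b)\lhd c=(a\lhd c)\lhd(b\lhd c)$. The adjoint group $\mathrm{As}(X)$ has generators $e_x$ and relations $e_{x\lhd y}=e_y^{-1}e_xe_y$; it acts on $X$ by $x\cdot e_y=x\lhd y$; $X$ is connected if this action is transitive. $\varepsilon_0:\mathrm{As}(X)\to\mathbb{Z}$ sends every $e_x$ to $1$. The extended quandle $\widetilde X$ is $\mathrm{Ker}(\varepsilon_0)$ with operation $g\lhd h=e_a^{-1}gh^{-1}e_ah$. The type $t_X$ is the smallest positive $N$ with $x\lhd^N y=x$ for all $x,y$. Quandle homology: $C_n^R(X)$ is the free abelian group on $X^n$ with boundary $\partial_n(x_1,\dots,x_n)=\sum_{i=1}^n(-1)^i\big((x_1\lhd x_i,\dots,x_{i-1}\lhd x_i,x_{i+1},\dots,x_n)-(x_1,\dots,x_{i-1},x_{i+1},\dots,x_n)\big)$; $C_n^D(X)$ is spanned by tuples with $x_i=x_{i+1}$ for some $i$; $H_n^Q(X)$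 is the homology of $C_*^R(X)/C_*^D(X)$. *)

theory Defs
  imports "HOL-Algebra.Algebra"
begin

definition quandle :: "'a set \<Rightarrow> ('a \<Rightarrow> 'a \<Rightarrow> 'a) \<Rightarrow> bool" where
  "quandle Q qop \<longleftrightarrow>
     (\<forall>x\<in>Q. \<forall>y\<in>Q. qop x y \<in> Q) \<and>
     (\<forall>a\<in>Q. qop a a = a) \<and>
     (\<forall>a\<in>Q. bij_betw (\<lambda>x. qop x a) Q Q) \<and>
     (\<forall>a\<in>Q. \<forall>b\<in>Q. \<forall>c\<in>Q. qop (qop a b) c = qop (qop a c) (qop b c))"

text \<open>A letter (x, True) stands for e_x, and (x, False) for e_x^{-1}.\<close>
definition words :: "'a set \<Rightarrow> ('a \<times> bool) list set" where
  "words Q = {w. fst ` set w \<subseteq> Q}"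

inductive as_eq :: "'a set \<Rightarrow> ('a \<Rightarrow> 'a \<Rightarrow> 'a) \<Rightarrow> ('a \<times> bool) list \<Rightarrow> ('a \<times> bool) list \<Rightarrow> bool"
  for Q qop where
  as_refl: "w \<in> words Q \<Longrightarrow> as_eq Q qop w w"
| as_sym: "as_eq Q qop u v \<Longrightarrow> as_eq Q qop v u"
| as_trans: "as_eq Q qop u v \<Longrightarrow> as_eq Q qop v w \<Longrightarrow> as_eq Q qop u w"
| as_cancel: "u \<in> words Q \<Longrightarrow> v \<in> words Q \<Longrightarrow> x \<in> Q \<Longrightarrow>
     as_eq Q qop (u @ [(x, b), (x, \<not> b)] @ v) (u @ v)"
| as_rel: "u \<in> words Q \<Longrightarrow> v \<in> words Q \<Longrightarrow> x \<in> Q \<Longrightarrow> y \<in> Q \<Longrightarrow>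
     as_eq Q qop (u @ [(qop x y, True)] @ v) (u @ [(y, False), (x, True), (y, True)] @ v)"

definition as_class :: "'a set \<Rightarrow> ('a \<Rightarrow> 'a \<Rightarrow> 'a) \<Rightarrow> ('a \<times> bool) list \<Rightarrow> ('a \<times> bool) list set" where
  "as_class Q qop w = {v. as_eq Q qop w v}"

text \<open>The adjoint group As(Q) = < e_x (x \<in> Q) | e_{x \<lhd> y} = e_y^{-1} e_x e_y >.\<close>
definition As :: "'a set \<Rightarrow> ('a \<Rightarrow> 'a \<Rightarrow> 'a) \<Rightarrow> (('a \<times> bool) list set) monoid" where
  "As Q qop = \<lparr> carrier = as_class Q qop ` words Q,
               monoid.mult = (\<lambda>A B. {w. \<exists>u\<in>A. \<exists>v\<in>B. as_eq Q qop (u @ v) w}),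
               one = as_class Q qop [] \<rparr>"

definition as_gen :: "'a set \<Rightarrow> ('a \<Rightarrow> 'a \<Rightarrow> 'a) \<Rightarrow> 'a \<Rightarrow> ('a \<times> bool) list set" where
  "as_gen Q qop x = as_class Q qop [(x, True)]"

fun act_word :: "'a set \<Rightarrow> ('a \<Rightarrow> 'a \<Rightarrow> 'a) \<Rightarrow> 'a \<Rightarrow> ('a \<times> bool) list \<Rightarrow> 'a" where
  "act_word Q qop x [] = x"
| "act_word Q qop x ((y, True) # w) = act_word Q qop (qop x y) w"
| "act_word Q qop x ((y, False) # w) = act_word Q qop (inv_into Q (\<lambda>z. qop z y) x) w"

definition act :: "'a set \<Rightarrow> ('a \<Rightarrow> 'a \<Rightarrow> 'a) \<Rightarrow> 'a \<Rightarrow> ('a \<times> bool) list set \<Rightarrow> 'a" where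
  "act Q qop x g = act_word Q qop x (SOME w. w \<in> g)"

definition quandle_connected :: "'a set \<Rightarrow> ('a \<Rightarrow> 'a \<Rightarrow> 'a) \<Rightarrow> bool" where
  "quandle_connected Q qop \<longleftrightarrow>
     (\<forall>x\<in>Q. \<forall>y\<in>Q. \<exists>g\<in>carrier (As Q qop). act Q qop x g = y)"

definition word_deg :: "('a \<times> bool) list \<Rightarrow> int" where
  "word_deg w = (\<Sum>l\<leftarrow>w. if snd l then 1 else -1)"

definition eps0 :: "('a \<times> bool) list set \<Rightarrow> int" where
  "eps0 g = word_deg (SOME w. w \<in> g)"

definition ext_carrier :: "'a set \<Rightarrow> ('a \<Rightarrow> 'a \<Rightarrow> 'a) \<Rightarrow> ('a \<times> bool) list set set" where
  "ext_carrier Q qop = {g \<in> carrier (As Q qop). eps0 g = 0}"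

definition ext_op :: "'a set \<Rightarrow> ('a \<Rightarrow> 'a \<Rightarrow> 'a) \<Rightarrow> 'a
    \<Rightarrow> ('a \<times> bool) list set \<Rightarrow> ('a \<times> bool) list set \<Rightarrow> ('a \<times> bool) list set" where
  "ext_op Q qop a g h =
     inv\<^bsub>As Q qop\<^esub> (as_gen Q qop a) \<otimes>\<^bsub>As Q qop\<^esub> g \<otimes>\<^bsub>As Q qop\<^esub> inv\<^bsub>As Q qop\<^esub> h
       \<otimes>\<^bsub>As Q qop\<^esub> as_gen Q qop a \<otimes>\<^bsub>As Q qop\<^esub> h"

definition cover :: "'a set \<Rightarrow> ('a \<Rightarrow> 'a \<Rightarrow> 'a) \<Rightarrow> 'a \<Rightarrow> ('a \<times> bool) list set \<Rightarrow> 'a" where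
  "cover Q qop a g = act Q qop a g"

definition cover_hom :: "'a set \<Rightarrow> ('a \<Rightarrow> 'a \<Rightarrow> 'a) \<Rightarrow> 'a
    \<Rightarrow> ((('a \<times> bool) list set) \<times> bool) list set \<Rightarrow> ('a \<times> bool) list set" where
  "cover_hom Q qop a G =
     as_class Q qop (map (\<lambda>(g, b). (cover Q qop a g, b)) (SOME w. w \<in> G))"

definition has_finite_type :: "'a set \<Rightarrow> ('a \<Rightarrow> 'a \<Rightarrow> 'a) \<Rightarrow> bool" where
  "has_finite_type Q qop \<longleftrightarrow> (\<exists>N>0. \<forall>x\<in>Q. \<forall>y\<in>Q. ((\<lambda>z. qop z y) ^^ N) x = x)"

definition quandle_type :: "'a set \<Rightarrow> ('a \<Rightarrow> 'a \<Rightarrow> 'a) \<Rightarrow> nat" where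
  "quandle_type Q qop = (LEAST N. N > 0 \<and> (\<forall>x\<in>Q. \<forall>y\<in>Q. ((\<lambda>z. qop z y) ^^ N) x = x))"

definition tuples :: "nat \<Rightarrow> 'a set \<Rightarrow> 'a list set" where
  "tuples n Q = {t. length t = n \<and> set t \<subseteq> Q}"

definition degen_tuples :: "nat \<Rightarrow> 'a set \<Rightarrow> 'a list set" where
  "degen_tuples n Q = {t \<in> tuples n Q. \<exists>i. Suc i < n \<and> t ! i = t ! Suc i}"

text \<open>Boundary of a basis tuple (x_1,...,x_n); index i (0-based) corresponds to i+1.\<close>
definition bd_basis :: "('a \<Rightarrow> 'a \<Rightarrow> 'a) \<Rightarrow> 'a list \<Rightarrow> 'a list \<Rightarrow>\<^sub>0 int" where
  "bd_basis qop t = (\<Sum>i<length t.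
      frag_cmul ((-1) ^ (Suc i))
        (frag_of (map (\<lambda>x. qop x (t ! i)) (take i t) @ drop (Suc i) t)
         - frag_of (take i t @ drop (Suc i) t)))"

definition bd :: "('a \<Rightarrow> 'a \<Rightarrow> 'a) \<Rightarrow> ('a list \<Rightarrow>\<^sub>0 int) \<Rightarrow> 'a list \<Rightarrow>\<^sub>0 int" where
  "bd qop c = frag_extend (bd_basis qop) c"

abbreviation CR :: "nat \<Rightarrow> 'a set \<Rightarrow> ('a list \<Rightarrow>\<^sub>0 int) monoid" where
  "CR n Q \<equiv> free_Abelian_group (tuples n Q)"

abbreviation CD :: "nat \<Rightarrow> 'a set \<Rightarrow> ('a list \<Rightarrow>\<^sub>0 int) set" where
  "CD n Q \<equiv> carrier (free_Abelian_group (degen_tuples n Q))"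

text \<open>Homology of C^R/C^D in degree n \<ge> 1, written out as relative cycles modulo
  relative boundaries: {c \<in> C_n^R. \<partial> c \<in> C_{n-1}^D} / (\<partial> C_{n+1}^R + C_n^D).\<close>
definition qcycles :: "nat \<Rightarrow> 'a set \<Rightarrow> ('a \<Rightarrow> 'a \<Rightarrow> 'a) \<Rightarrow> ('a list \<Rightarrow>\<^sub>0 int) set" where
  "qcycles n Q qop = {c \<in> carrier (CR n Q). bd qop c \<in> CD (n - 1) Q}"

definition qboundaries :: "nat \<Rightarrow> 'a set \<Rightarrow> ('a \<Rightarrow> 'a \<Rightarrow> 'a) \<Rightarrow> ('a list \<Rightarrow>\<^sub>0 int) set" where
  "qboundaries n Q qop = {bd qop c + d | c d. c \<in> carrier (CR (Suc n) Q) \<and> d \<in> CD n Q}"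

definition HQ :: "nat \<Rightarrow> 'a set \<Rightarrow> ('a \<Rightarrow> 'a \<Rightarrow> 'a) \<Rightarrow> ('a list \<Rightarrow>\<^sub>0 int) set monoid" where
  "HQ n Q qop = subgroup_generated (CR n Q) (qcycles n Q qop) Mod qboundaries n Q qop"

end

theory Submission
  imports Defs
begin

text \<open>
  For a connected quandle with base point \<open>b\<close>, let \<open>loops b\<close> be the subgroup of the elements of the
  adjoint group that have degree 0 and fix \<open>b\<close>. If this subgroup is commutative, it is isomorphic to
  the second quandle homology (Eisermann). In one direction, a word becomes the sum of the pairs
  \<open>(x, y)\<close> that it traverses in the Cayley graph, and this sum depends only on the group element
  modulo boundaries. In the other direction, a choice of degree 0 elements \<open>s x\<close> with
  \<open>b \<cdot> s x = x\<close> gives the 2-cocycle \<open>s x e\<^sub>y (s (x \<lhd> y))\<^sup>-\<^sup>1 e\<^sub>b\<^sup>-\<^sup>1\<close>.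

  In the extended quandle, \<open>g \<cdot> x = e\<^sub>a\<^sup>-\<^sup>k g p\<^sub>*(x)\<close> with \<open>k\<close> the degree of \<open>x\<close>. Hence the loops
  at 1 are the kernel of \<open>p\<^sub>*\<close>, and they act trivially, so they are central.

  If \<open>n\<close> is a period of the quandle, then in both adjoint groups the \<open>n\<close>-th powers of the generators
  are central and all equal. Generators of \<open>As\<close> of the extended quandle with the same image under
  \<open>p\<close> therefore differ by a kernel element of order dividing \<open>n\<close>. Modulo such elements, a section of
  \<open>p\<close> respects the defining relations and recovers every word from its image, so every
  element of the kernel has order dividing \<open>n\<close>.
\<close>

section \<open>The adjoint group\<close>

text \<open>Together with \<open>m_assoc\<close>, these rules delete adjacent inverse pairs inside
  right-nested products.\<close>

lemma (in group) inv_mult_cancel_left [simp]: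
  "\<lbrakk>x \<in> carrier G; y \<in> carrier G\<rbrakk> \<Longrightarrow> inv x \<otimes> (x \<otimes> y) = y"
  and mult_inv_cancel_left [simp]:
  "\<lbrakk>x \<in> carrier G; y \<in> carrier G\<rbrakk> \<Longrightarrow> x \<otimes> (inv x \<otimes> y) = y"
  by (simp_all flip: m_assoc)

locale quandle_on =
  fixes Q :: "'a set" and qop :: "'a \<Rightarrow> 'a \<Rightarrow> 'a"
  assumes quandle: "quandle Q qop"
begin

abbreviation rinv :: "'a \<Rightarrow> 'a \<Rightarrow> 'a" where
  "rinv x y \<equiv> inv_into Q (\<lambda>z. qop z y) x"

abbreviation G where "G \<equiv> As Q qop"
abbreviation cls where "cls \<equiv> as_class Q qop"
abbreviation gen where "gen \<equiv> as_gen Q qop"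

lemma op_closed [simp]: "x \<in> Q \<Longrightarrow> y \<in> Q \<Longrightarrow> qop x y \<in> Q"
  and op_idem [simp]: "x \<in> Q \<Longrightarrow> qop x x = x"
  and op_bij: "y \<in> Q \<Longrightarrow> bij_betw (\<lambda>z. qop z y) Q Q"
  and op_distrib: "\<lbrakk>x \<in> Q; y \<in> Q; z \<in> Q\<rbrakk> \<Longrightarrow> qop (qop x y) z = qop (qop x z) (qop y z)"
  using quandle unfolding quandle_def by blast+

lemma rinv_closed [simp]: "x \<in> Q \<Longrightarrow> y \<in> Q \<Longrightarrow> rinv x y \<in> Q"
  using op_bij[of y] by (metis bij_betw_def inv_into_into)

lemma op_rinv [simp]: "x \<in> Q \<Longrightarrow> y \<in> Q \<Longrightarrow> qop (rinv x y) y = x"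
  using op_bij[of y] bij_betw_inv_into_right by fastforce

lemma rinv_op [simp]: "x \<in> Q \<Longrightarrow> y \<in> Q \<Longrightarrow> rinv (qop x y) y = x"
  using op_bij[of y] bij_betw_inv_into_left by fastforce

lemma rinv_self [simp]: "x \<in> Q \<Longrightarrow> rinv x x = x"
  using rinv_op[of x x] by simp

section \<open>Words and the congruence that presents the adjoint group\<close>

lemma words_simps [simp]:
  "[] \<in> words Q"
  "p # w \<in> words Q \<longleftrightarrow> fst p \<in> Q \<and> w \<in> words Q"
  "u @ v \<in> words Q \<longleftrightarrow> u \<in> words Q \<and> v \<in> words Q"
  by (auto simp: words_def)

lemma as_eq_words: "as_eq Q qop u v \<Longrightarrow> u \<in> words Q \<and> v \<in> words Q"
  by (induction rule: as_eq.induct) auto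

lemma as_eq_append_left:
  assumes "as_eq Q qop u v" "w \<in> words Q"
  shows "as_eq Q qop (w @ u) (w @ v)"
  using assms
proof (induction rule: as_eq.induct)
  case (as_cancel u v x b)
  then show ?case using as_eq.as_cancel[of "w @ u" Q v x qop b] by simp
next
  case (as_rel u v x y)
  then show ?case using as_eq.as_rel[of "w @ u" Q v x y qop] by simp
qed (auto intro: as_eq.intros)

lemma as_eq_append_right:
  assumes "as_eq Q qop u v" "w \<in> words Q"
  shows "as_eq Q qop (u @ w) (v @ w)"
  using assms
proof (induction rule: as_eq.induct)
  case (as_cancel u v x b)
  then show ?case using as_eq.as_cancel[of u Q "v @ w" x qop b] by simp
next
  case (as_rel u v x y)
  then show ?case using as_eq.as_rel[of u Q "v @ w" x y qop] by simp
qed (auto intro: as_eq.intros)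

lemma as_eq_append:
  assumes "as_eq Q qop u u'" "as_eq Q qop v v'"
  shows "as_eq Q qop (u @ v) (u' @ v')"
  using assms by (meson as_eq_append_left as_eq_append_right as_eq_words as_trans)

lemma cls_eq_iff: "u \<in> words Q \<Longrightarrow> cls u = cls v \<longleftrightarrow> as_eq Q qop u v"
  unfolding as_class_def by (auto intro: as_eq.intros)

lemma in_cls: "w \<in> words Q \<Longrightarrow> w \<in> cls w"
  by (simp add: as_class_def as_refl)

text \<open>\<open>act\<close>, \<open>eps0\<close>, \<open>cover_hom\<close> and
  \<open>class_chain\<close> all read off a chosen representative; this fact lets them be evaluated
  on any word of the class.\<close>

lemma some_rep:
  assumes "w \<in> words Q"
  shows "as_eq Q qop w (SOME v. v \<in> cls w)"
  using someI[of "\<lambda>v. v \<in> cls w", OF in_cls[OF assms]] by (simp add: as_class_def)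

section \<open>The group structure on classes of words\<close>

lemma carrier_As: "carrier G = cls ` words Q"
  by (simp add: As_def)

lemma cls_closed [simp]: "w \<in> words Q \<Longrightarrow> cls w \<in> carrier G"
  by (simp add: carrier_As)

lemma one_As: "\<one>\<^bsub>G\<^esub> = cls []"
  by (simp add: As_def)

lemma cls_append:
  assumes "u \<in> words Q" "v \<in> words Q"
  shows "cls (u @ v) = cls u \<otimes>\<^bsub>G\<^esub> cls v"
proof -
  have "as_eq Q qop (u @ v) w" if "as_eq Q qop u u'" "as_eq Q qop v v'" "as_eq Q qop (u' @ v') w" for u' v' w
    using that as_eq_append as_trans by meson
  then show ?thesis
    using assms by (auto simp: As_def as_class_def intro: as_refl)
qed

lemma cls_cancel: "x \<in> Q \<Longrightarrow> cls [(x, b), (x, \<not> b)] = cls []"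
  using as_cancel[of "[]" Q "[]" x qop b] by (simp add: cls_eq_iff)

lemma cls_left_inverse:
  assumes "w \<in> words Q"
  shows "\<exists>v\<in>words Q. cls (v @ w) = cls []"
  using assms
proof (induction w)
  case Nil
  then show ?case by (auto intro: bexI[of _ "[]"])
next
  case (Cons p w)
  obtain x b where p: "p = (x, b)" by force
  from Cons obtain v where v: "v \<in> words Q" "cls (v @ w) = cls []" by auto
  \<comment> \<open>The inverse of the first letter is appended to \<open>v\<close>, so that the
    pair cancels in the middle. The double negation brings the letter \<open>(x, b)\<close> into the
    shape of the rule \<open>as_cancel\<close>.\<close>
  have "as_eq Q qop (v @ [(x, \<not> b), (x, \<not> \<not> b)] @ w) (v @ w)"
    using Cons v p by (intro as_cancel) auto
  then have "cls ((v @ [(x, \<not> b)]) @ p # w) = cls (v @ w)"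
    using p v Cons.prems by (subst cls_eq_iff) auto
  then show ?case using v Cons.prems p by (intro bexI[of _ "v @ [(x, \<not> b)]"]) auto
qed

sublocale As: group G
proof (rule groupI)
  fix g h k assume "g \<in> carrier G" "h \<in> carrier G" "k \<in> carrier G"
  then show "g \<otimes>\<^bsub>G\<^esub> h \<otimes>\<^bsub>G\<^esub> k = g \<otimes>\<^bsub>G\<^esub> (h \<otimes>\<^bsub>G\<^esub> k)"
    by (auto simp: carrier_As simp flip: cls_append)
next
  fix g assume "g \<in> carrier G"
  then show "\<exists>h\<in>carrier G. h \<otimes>\<^bsub>G\<^esub> g = \<one>\<^bsub>G\<^esub>"
    using cls_left_inverse by (fastforce simp: carrier_As one_As simp flip: cls_append)
qed (auto simp: carrier_As one_As simp flip: cls_append)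

lemma gen_closed [simp]: "x \<in> Q \<Longrightarrow> gen x \<in> carrier G"
  by (simp add: as_gen_def)

lemma cls_neg_letter: "x \<in> Q \<Longrightarrow> cls [(x, False)] = inv\<^bsub>G\<^esub> (gen x)"
  using cls_cancel[of x False]
  by (intro As.inv_equality[symmetric]) (auto simp: as_gen_def one_As simp flip: cls_append)

lemma cls_Cons:
  assumes "x \<in> Q" "w \<in> words Q"
  shows "cls ((x, True) # w) = gen x \<otimes>\<^bsub>G\<^esub> cls w"
    and "cls ((x, False) # w) = inv\<^bsub>G\<^esub> (gen x) \<otimes>\<^bsub>G\<^esub> cls w"
  using cls_append[of "[(x, True)]" w] cls_append[of "[(x, False)]" w] assms
  by (simp_all add: cls_neg_letter as_gen_def)

text \<open>Letters are split off at the end of a word. This fits the right action, in which the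
  last factor acts last.\<close>

lemma As_induct [consumes 1, case_names one mult mult_inv]:
  assumes "g \<in> carrier G" and "P \<one>\<^bsub>G\<^esub>"
    and "\<And>g y. \<lbrakk>g \<in> carrier G; y \<in> Q; P g\<rbrakk> \<Longrightarrow> P (g \<otimes>\<^bsub>G\<^esub> gen y)"
    and "\<And>g y. \<lbrakk>g \<in> carrier G; y \<in> Q; P g\<rbrakk> \<Longrightarrow> P (g \<otimes>\<^bsub>G\<^esub> inv\<^bsub>G\<^esub> (gen y))"
  shows "P g"
proof -
  have "w \<in> words Q \<Longrightarrow> P (cls w)" for w
  proof (induction w rule: rev_induct)
    case Nil
    then show ?case using assms by (simp add: one_As)
  next
    case (snoc p w)
    obtain x b where "p = (x, b)" by force
    then show ?case
      using snoc assms(3,4)[of "cls w" x] by (cases b) (auto simp: cls_append cls_neg_letter as_gen_def)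
  qed
  then show ?thesis using assms(1) by (auto simp: carrier_As)
qed

lemma gen_op:
  assumes "x \<in> Q" "y \<in> Q"
  shows "gen (qop x y) = inv\<^bsub>G\<^esub> (gen y) \<otimes>\<^bsub>G\<^esub> gen x \<otimes>\<^bsub>G\<^esub> gen y"
proof -
  have "gen (qop x y) = cls [(y, False), (x, True), (y, True)]"
    using as_rel[of "[]" Q "[]" x y qop] assms by (simp add: as_gen_def cls_eq_iff)
  also have "\<dots> = inv\<^bsub>G\<^esub> (gen y) \<otimes>\<^bsub>G\<^esub> (gen x \<otimes>\<^bsub>G\<^esub> gen y)"
    using assms cls_Cons(2)[of y "[(x, True), (y, True)]"] cls_append[of "[(x, True)]" "[(y, True)]"]
    by (simp add: as_gen_def)
  finally show ?thesis using assms by (simp add: As.m_assoc)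
qed

section \<open>The right action on the quandle\<close>

lemma act_word_closed [simp]: "x \<in> Q \<Longrightarrow> w \<in> words Q \<Longrightarrow> act_word Q qop x w \<in> Q"
proof (induction w arbitrary: x)
  case (Cons p w)
  then show ?case by (cases p; cases "snd p") auto
qed simp

lemma act_word_append: "act_word Q qop x (u @ v) = act_word Q qop (act_word Q qop x u) v"
  by (induction Q qop x u rule: act_word.induct) auto

lemma act_word_cong:
  assumes "as_eq Q qop u v" "x \<in> Q"
  shows "act_word Q qop x u = act_word Q qop x v"
  using assms
proof (induction rule: as_eq.induct)
  case (as_cancel u v y b)
  then show ?case by (cases b) (auto simp: act_word_append)
next
  case (as_rel u v y z)
  define t where "t = act_word Q qop x u"
  have t: "t \<in> Q" using as_rel by (simp add: t_def)
  \<comment> \<open>Self-distributivity at \<open>rinv t z\<close> is exactly the invariance of the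
    action under the defining relation.\<close>
  have "qop (qop (rinv t z) y) z = qop t (qop y z)"
    using as_rel t op_distrib[of "rinv t z" y z] by simp
  then show ?case using as_rel by (simp add: act_word_append t_def)
qed auto

lemma act_cls: "x \<in> Q \<Longrightarrow> w \<in> words Q \<Longrightarrow> act Q qop x (cls w) = act_word Q qop x w"
  unfolding act_def using act_word_cong[OF some_rep] by simp

lemma act_closed [simp]: "x \<in> Q \<Longrightarrow> g \<in> carrier G \<Longrightarrow> act Q qop x g \<in> Q"
  by (auto simp: carrier_As act_cls)

lemma act_mult:
  "\<lbrakk>x \<in> Q; g \<in> carrier G; h \<in> carrier G\<rbrakk> \<Longrightarrow>
    act Q qop x (g \<otimes>\<^bsub>G\<^esub> h) = act Q qop (act Q qop x g) h"
  by (auto simp: carrier_As act_cls act_word_append simp flip: cls_append)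

lemma act_one [simp]: "x \<in> Q \<Longrightarrow> act Q qop x \<one>\<^bsub>G\<^esub> = x"
  by (simp add: one_As act_cls)

lemma act_gen [simp]: "x \<in> Q \<Longrightarrow> y \<in> Q \<Longrightarrow> act Q qop x (gen y) = qop x y"
  by (simp add: as_gen_def act_cls)

lemma act_inv_gen [simp]: "x \<in> Q \<Longrightarrow> y \<in> Q \<Longrightarrow> act Q qop x (inv\<^bsub>G\<^esub> (gen y)) = rinv x y"
  by (simp add: act_cls flip: cls_neg_letter)

lemma act_inv:
  "\<lbrakk>x \<in> Q; g \<in> carrier G; act Q qop x g = y\<rbrakk> \<Longrightarrow> act Q qop y (inv\<^bsub>G\<^esub> g) = x"
  using act_mult[of x g "inv\<^bsub>G\<^esub> g"] by simp

text \<open>For a single generator this is the defining relation. It extends to products because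
  both the action and conjugation are right actions.\<close>

lemma gen_act:
  assumes "g \<in> carrier G" "x \<in> Q"
  shows "gen (act Q qop x g) = inv\<^bsub>G\<^esub> g \<otimes>\<^bsub>G\<^esub> gen x \<otimes>\<^bsub>G\<^esub> g"
  using assms
proof (induction rule: As_induct)
  case one
  then show ?case by simp
next
  case (mult g y)
  then show ?case by (simp add: act_mult gen_op As.inv_mult_group As.m_assoc)
next
  case (mult_inv g y)
  define t where "t = act Q qop x g"
  have t: "t \<in> Q" using mult_inv by (simp add: t_def)
  \<comment> \<open>For an inverse generator, the defining relation at \<open>rinv t y\<close> is
    solved for \<open>gen (rinv t y)\<close>.\<close>
  have "gen t = inv\<^bsub>G\<^esub> (gen y) \<otimes>\<^bsub>G\<^esub> gen (rinv t y) \<otimes>\<^bsub>G\<^esub> gen y"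
    using gen_op[of "rinv t y" y] mult_inv t by simp
  then have "gen y \<otimes>\<^bsub>G\<^esub> gen t = gen (rinv t y) \<otimes>\<^bsub>G\<^esub> gen y"
    using mult_inv t by (simp add: As.m_assoc As.inv_solve_left)
  then have "gen (rinv t y) = gen y \<otimes>\<^bsub>G\<^esub> gen t \<otimes>\<^bsub>G\<^esub> inv\<^bsub>G\<^esub> (gen y)"
    using mult_inv t by (simp add: As.inv_solve_right)
  then show ?case
    using mult_inv by (simp add: act_mult As.inv_mult_group As.m_assoc t_def)
qed

section \<open>The degree homomorphism\<close>

lemma word_deg_append: "word_deg (u @ v) = word_deg u + word_deg v"
  by (simp add: word_deg_def)

lemma word_deg_cong: "as_eq Q qop u v \<Longrightarrow> word_deg u = word_deg v"
  by (induction rule: as_eq.induct) (auto simp: word_deg_def)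

lemma eps0_cls: "w \<in> words Q \<Longrightarrow> eps0 (cls w) = word_deg w"
  unfolding eps0_def using word_deg_cong[OF some_rep] by simp

lemma eps0_mult: "\<lbrakk>g \<in> carrier G; h \<in> carrier G\<rbrakk> \<Longrightarrow> eps0 (g \<otimes>\<^bsub>G\<^esub> h) = eps0 g + eps0 h"
  by (auto simp: carrier_As eps0_cls word_deg_append simp flip: cls_append)

lemma eps0_one [simp]: "eps0 \<one>\<^bsub>G\<^esub> = 0"
  by (simp add: one_As eps0_cls word_deg_def)

lemma eps0_gen [simp]: "x \<in> Q \<Longrightarrow> eps0 (gen x) = 1"
  by (simp add: as_gen_def eps0_cls word_deg_def)

lemma eps0_inv [simp]: "g \<in> carrier G \<Longrightarrow> eps0 (inv\<^bsub>G\<^esub> g) = - eps0 g"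
  using eps0_mult[of g "inv\<^bsub>G\<^esub> g"] by simp

lemma eps0_int_pow: "g \<in> carrier G \<Longrightarrow> eps0 (g [^]\<^bsub>G\<^esub> (n::int)) = n * eps0 g"
proof (induction n rule: int_induct[where k = 0])
  case (step1 i)
  then show ?case by (simp add: As.int_pow_mult eps0_mult algebra_simps)
next
  case (step2 i)
  then show ?case by (simp add: As.int_pow_diff eps0_mult algebra_simps)
qed simp

lemma act_gen_self_int_pow: "x \<in> Q \<Longrightarrow> act Q qop x (gen x [^]\<^bsub>G\<^esub> (n::int)) = x"
proof (induction n rule: int_induct[where k = 0])
  case (step1 i)
  then show ?case by (simp add: As.int_pow_mult act_mult)
next
  case (step2 i)
  then show ?case by (simp add: As.int_pow_diff act_mult)
qed simp

text \<open>By idempotence every power of \<open>gen x\<close> fixes \<open>x\<close>, so a suitable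
  power put in front corrects the degree without changing the end point.\<close>

lemma connected_degree_zero:
  assumes "quandle_connected Q qop" "x \<in> Q" "y \<in> Q"
  obtains g where "g \<in> carrier G" "eps0 g = 0" "act Q qop x g = y"
proof -
  obtain g where g: "g \<in> carrier G" "act Q qop x g = y"
    using assms unfolding quandle_connected_def by blast
  show ?thesis
    using assms g
    by (intro that[of "gen x [^]\<^bsub>G\<^esub> (- eps0 g) \<otimes>\<^bsub>G\<^esub> g"])
      (auto simp: eps0_mult eps0_int_pow act_mult act_gen_self_int_pow )
qed

end

section \<open>Second quandle homology\<close>

lemma bd_frag_of [simp]: "bd qop (frag_of t) = bd_basis qop t"
  and bd_0 [simp]: "bd qop 0 = 0"
  and bd_add: "bd qop (c + d) = bd qop c + bd qop d"
  and bd_diff: "bd qop (c - d) = bd qop c - bd qop d"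
  by (simp_all add: bd_def frag_extend_add frag_extend_diff)

text \<open>The two faces at the first entry coincide and cancel, so here and for triples only the
  later entries contribute.\<close>

lemma bd_basis_2: "bd_basis qop [x, y] = frag_of [qop x y] - frag_of [x]"
  by (simp add: bd_basis_def numeral_2_eq_2)

lemma bd_basis_3:
  "bd_basis qop [x, y, z] =
    frag_of [qop x y, z] - frag_of [x, z] - (frag_of [qop x z, qop y z] - frag_of [x, y])"
  by (simp add: bd_basis_def numeral_3_eq_3)

lemma tuples_2: "tuples 2 Q = {[x, y] |x y. x \<in> Q \<and> y \<in> Q}"
  by (auto simp: tuples_def numeral_2_eq_2 length_Suc_conv)

lemma pair_in_tuples: "[x, y] \<in> tuples 2 Q \<longleftrightarrow> x \<in> Q \<and> y \<in> Q"
  by (auto simp: tuples_2)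

lemma tuples_3: "tuples 3 Q = {[x, y, z] |x y z. x \<in> Q \<and> y \<in> Q \<and> z \<in> Q}"
  by (auto simp: tuples_def numeral_3_eq_3 length_Suc_conv)

lemma degen_tuples_1: "degen_tuples 1 Q = {}"
  by (auto simp: degen_tuples_def)

lemma degen_tuples_2: "degen_tuples 2 Q = {[x, x] |x. x \<in> Q}"
  by (auto simp: degen_tuples_def tuples_2 less_Suc_eq)

lemma keys_addI: "Poly_Mapping.keys c \<subseteq> S \<Longrightarrow> Poly_Mapping.keys d \<subseteq> S \<Longrightarrow> Poly_Mapping.keys (c + d) \<subseteq> S"
  for c d :: "'a \<Rightarrow>\<^sub>0 'b::monoid_add"
  using keys_add[of c d] by blast

lemma keys_diffI: "Poly_Mapping.keys c \<subseteq> S \<Longrightarrow> Poly_Mapping.keys d \<subseteq> S \<Longrightarrow> Poly_Mapping.keys (c - d) \<subseteq> S"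
  for c d :: "'a \<Rightarrow>\<^sub>0 int"
  using keys_diff[of c d] by blast

context quandle_on
begin

section \<open>Boundaries and cycles in degree two\<close>

abbreviation bounds where "bounds \<equiv> qboundaries 2 Q qop"

lemma bounds_diff:
  assumes "c \<in> bounds" "d \<in> bounds"
  shows "c - d \<in> bounds"
proof -
  obtain c1 c2 d1 d2 where c: "c = bd qop c1 + c2" "Poly_Mapping.keys c1 \<subseteq> tuples 3 Q" "Poly_Mapping.keys c2 \<subseteq> degen_tuples 2 Q"
    and d: "d = bd qop d1 + d2" "Poly_Mapping.keys d1 \<subseteq> tuples 3 Q" "Poly_Mapping.keys d2 \<subseteq> degen_tuples 2 Q"
    using assms by (auto simp: qboundaries_def)
  have "c - d = bd qop (c1 - d1) + (c2 - d2)" "Poly_Mapping.keys (c1 - d1) \<subseteq> tuples 3 Q"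
    "Poly_Mapping.keys (c2 - d2) \<subseteq> degen_tuples 2 Q"
    using c d by (simp_all add: bd_diff keys_diffI)
  then show ?thesis by (auto simp: qboundaries_def)
qed

lemma bounds_0 [simp]: "0 \<in> bounds"
  unfolding qboundaries_def by (intro CollectI exI[of _ 0]) simp

lemma bounds_minus: "c \<in> bounds \<Longrightarrow> - c \<in> bounds"
  using bounds_diff[of 0 c] by simp

lemma bounds_add: "\<lbrakk>c \<in> bounds; d \<in> bounds\<rbrakk> \<Longrightarrow> c + d \<in> bounds"
  using bounds_diff[of c "- d"] by (simp add: bounds_minus)

lemma degenerate_in_bounds: "x \<in> Q \<Longrightarrow> frag_of [x, x] \<in> bounds"
  unfolding qboundaries_def by (intro CollectI exI[of _ 0] exI) (auto simp: degen_tuples_2)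

lemma boundary_in_bounds: "\<lbrakk>x \<in> Q; y \<in> Q; z \<in> Q\<rbrakk> \<Longrightarrow> bd_basis qop [x, y, z] \<in> bounds"
  unfolding qboundaries_def
  by (intro CollectI exI[of _ "frag_of [x, y, z]"] exI[of _ 0]) (auto simp: tuples_3)

text \<open>Free Abelian groups are generated by their basis under differences, and
  \<open>bd\<close> is additive. Additive properties of boundaries can therefore be tested on
  degenerate pairs and on boundaries of triples.\<close>

lemma bounds_induct [consumes 1, case_names zero degenerate boundary diff]:
  assumes "c \<in> bounds" and 0: "P 0"
    and degenerate: "\<And>x. x \<in> Q \<Longrightarrow> P (frag_of [x, x])"
    and boundary: "\<And>x y z. \<lbrakk>x \<in> Q; y \<in> Q; z \<in> Q\<rbrakk> \<Longrightarrow> P (bd_basis qop [x, y, z])"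
    and diff: "\<And>c d. \<lbrakk>P c; P d\<rbrakk> \<Longrightarrow> P (c - d)"
  shows "P c"
proof -
  obtain c1 c2 where c: "c = bd qop c1 + c2" "Poly_Mapping.keys c1 \<subseteq> tuples 3 Q" "Poly_Mapping.keys c2 \<subseteq> degen_tuples 2 Q"
    using assms(1) by (auto simp: qboundaries_def)
  have "P (bd qop c1)"
    using c(2)
  proof (induction rule: frag_induction)
    case (diff c d)
    then show ?case using assms by (simp add: bd_diff)
  qed (auto simp: tuples_3 assms)
  moreover have "P c2"
    using c(3) by (induction rule: frag_induction) (auto simp: degen_tuples_2 assms)
  \<comment> \<open>\<open>P\<close> is only assumed closed under differences, so the sum is written
    as one.\<close>
  ultimately have "P (bd qop c1 - (0 - c2))"
    by (intro diff 0)
  then show ?thesis by (simp add: c)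
qed

lemma bounds_chain: "c \<in> bounds \<Longrightarrow> Poly_Mapping.keys c \<subseteq> tuples 2 Q"
  by (induction rule: bounds_induct) (simp_all add: bd_basis_3 pair_in_tuples keys_diffI)

text \<open>On triples this is self-distributivity, on degenerate pairs it is idempotence.\<close>

lemma bd_bounds: "c \<in> bounds \<Longrightarrow> bd qop c = 0"
  by (induction rule: bounds_induct)
    (auto simp: bd_basis_3 bd_basis_2 bd_add bd_diff op_distrib[symmetric])

text \<open>There are no degenerate 1-tuples, so relative cycles of degree two are honest
  cycles.\<close>

lemma qcycles_2: "qcycles 2 Q qop = {c. Poly_Mapping.keys c \<subseteq> tuples 2 Q \<and> bd qop c = 0}"
  using degen_tuples_1[of Q] by (auto simp: qcycles_def)

section \<open>Chains along paths in the Cayley graph\<close>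

fun path_chain :: "'a \<Rightarrow> ('a \<times> bool) list \<Rightarrow> 'a list \<Rightarrow>\<^sub>0 int" where
  "path_chain x [] = 0"
| "path_chain x ((y, True) # w) = frag_of [x, y] + path_chain (qop x y) w"
| "path_chain x ((y, False) # w) = path_chain (rinv x y) w - frag_of [rinv x y, y]"

lemma path_chain_append:
  "path_chain x (u @ v) = path_chain x u + path_chain (act_word Q qop x u) v"
  by (induction x u rule: path_chain.induct) auto

lemma path_chain_closed: "x \<in> Q \<Longrightarrow> w \<in> words Q \<Longrightarrow> Poly_Mapping.keys (path_chain x w) \<subseteq> tuples 2 Q"
  by (induction x w rule: path_chain.induct) (auto simp: pair_in_tuples keys_addI keys_diffI)

text \<open>An inverse letter runs backwards along the edge from \<open>rinv x y\<close> to
  \<open>x\<close>, hence the minus sign in \<open>path_chain\<close>. Every step then contributes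
  its end minus its start and the sum telescopes, so a closed path gives a cycle.\<close>

lemma bd_path_chain:
  "x \<in> Q \<Longrightarrow> w \<in> words Q \<Longrightarrow> bd qop (path_chain x w) = frag_of [act_word Q qop x w] - frag_of [x]"
  by (induction x w rule: path_chain.induct) (auto simp: bd_add bd_diff bd_basis_2)

text \<open>A cancelling pair of letters runs along one edge back and forth, and a use of the
  defining relation changes the chain by the boundary of a triple.\<close>

lemma path_chain_cong:
  assumes "as_eq Q qop u v" "x \<in> Q"
  shows "path_chain x u - path_chain x v \<in> bounds"
  using assms
proof (induction rule: as_eq.induct)
  case (as_sym u v)
  then show ?case using bounds_minus by fastforce
next
  case (as_trans u v w)
  then show ?case using bounds_add by fastforce
next
  case (as_cancel u v y b)
  then show ?case by (cases b) (auto simp: path_chain_append act_word_append)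
next
  case (as_rel u v y z)
  \<comment> \<open>\<open>t\<close> is the point reached after the letter
    \<open>(z, False)\<close>; the triple in question is \<open>[t, y, z]\<close>.\<close>
  define t where "t = rinv (act_word Q qop x u) z"
  have t: "t \<in> Q" "act_word Q qop x u = qop t z" using as_rel by (simp_all add: t_def)
  \<comment> \<open>Both paths reach the same point, so the remaining word \<open>v\<close>
    contributes the same chain to each.\<close>
  have "qop (qop t z) (qop y z) = qop (qop t y) z"
    using as_rel t op_distrib[of t y z] by simp
  moreover have "- bd_basis qop [t, y, z] \<in> bounds"
    using as_rel t by (intro bounds_minus boundary_in_bounds)
  ultimately show ?case
    using as_rel t by (simp add: path_chain_append bd_basis_3 algebra_simps)
qed auto

definition class_chain :: "'a \<Rightarrow> ('a \<times> bool) list set \<Rightarrow> 'a list \<Rightarrow>\<^sub>0 int" where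
  "class_chain x g = path_chain x (SOME w. w \<in> g)"

lemma class_chain_cls:
  "x \<in> Q \<Longrightarrow> w \<in> words Q \<Longrightarrow> path_chain x w - class_chain x (cls w) \<in> bounds"
  unfolding class_chain_def by (intro path_chain_cong some_rep)

lemma class_chain_gen:
  "x \<in> Q \<Longrightarrow> y \<in> Q \<Longrightarrow> frag_of [x, y] - class_chain x (gen y) \<in> bounds"
  using class_chain_cls[of x "[(y, True)]"] by (simp add: as_gen_def)

text \<open>Paths for the two factors are concatenated, the second one starting where the first one
  ends.\<close>

lemma class_chain_mult:
  assumes "x \<in> Q" "g \<in> carrier G" "h \<in> carrier G"
  shows "class_chain x (g \<otimes>\<^bsub>G\<^esub> h) - (class_chain x g + class_chain (act Q qop x g) h) \<in> bounds"
proof -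
  obtain u v where uv: "u \<in> words Q" "g = cls u" "v \<in> words Q" "h = cls v"
    using assms by (auto simp: carrier_As)
  have "path_chain x u - class_chain x g \<in> bounds"
    "path_chain (act_word Q qop x u) v - class_chain (act_word Q qop x u) h \<in> bounds"
    "path_chain x (u @ v) - class_chain x (cls (u @ v)) \<in> bounds"
    using assms uv by (simp_all add: class_chain_cls)
  from bounds_diff[OF bounds_add[OF this(1,2)] this(3)]
  have "(path_chain x u - class_chain x g) +
      (path_chain (act_word Q qop x u) v - class_chain (act_word Q qop x u) h)
      - (path_chain x (u @ v) - class_chain x (cls (u @ v))) \<in> bounds" .
  then show ?thesis
    using assms uv by (simp add: path_chain_append act_cls cls_append algebra_simps)
qed

section \<open>Loops at a base point\<close>

definition loops :: "'a \<Rightarrow> ('a \<times> bool) list set set" where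
  "loops b = {g \<in> carrier G. eps0 g = 0 \<and> act Q qop b g = b}"

lemma subgroup_loops: "b \<in> Q \<Longrightarrow> subgroup (loops b) G"
  by (rule As.subgroupI) (auto simp: loops_def eps0_mult act_mult act_inv intro!: exI[of _ "\<one>\<^bsub>G\<^esub>"])

text \<open>Since \<open>g\<close> fixes \<open>b\<close>, \<open>gen_act\<close> says that
  conjugation by \<open>g\<close> fixes \<open>gen b\<close>.\<close>

lemma loop_commutes_gen:
  assumes "g \<in> loops b" "b \<in> Q"
  shows "gen b \<otimes>\<^bsub>G\<^esub> g = g \<otimes>\<^bsub>G\<^esub> gen b"
proof -
  have "gen b = inv\<^bsub>G\<^esub> g \<otimes>\<^bsub>G\<^esub> (gen b \<otimes>\<^bsub>G\<^esub> g)"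
    using assms gen_act[of g b] by (simp add: loops_def As.m_assoc)
  then show ?thesis
    using assms by (simp add: loops_def As.inv_solve_left)
qed

end

text \<open>The left-hand side has the shape that \<open>loop_hom\<close> takes on the boundary of a
  triple; the equation between products is the cocycle condition.\<close>

lemma (in comm_group) mult_inv_mult_inv_eq_one:
  assumes "a \<in> carrier G" "b \<in> carrier G" "c \<in> carrier G" "d \<in> carrier G" "a \<otimes> b = c \<otimes> d"
  shows "b \<otimes> inv c \<otimes> inv (d \<otimes> inv a) = \<one>"
proof -
  have "b \<otimes> inv c \<otimes> inv (d \<otimes> inv a) = a \<otimes> b \<otimes> inv (c \<otimes> d)"
    using assms(1-4) by (simp add: inv_mult m_ac)
  then show ?thesis using assms by simp
qed

locale pointed_quandle = quandle_on Q qop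
  for Q :: "'a set" and qop :: "'a \<Rightarrow> 'a \<Rightarrow> 'a" +
  fixes b :: 'a
  assumes base [simp]: "b \<in> Q"
    and connected: "quandle_connected Q qop"
    and loops_commute: "\<lbrakk>g \<in> loops b; h \<in> loops b\<rbrakk> \<Longrightarrow> g \<otimes>\<^bsub>G\<^esub> h = h \<otimes>\<^bsub>G\<^esub> g"
begin

abbreviation L where "L \<equiv> subgroup_generated G (loops b)"

lemma carrier_L [simp]: "carrier L = loops b"
  by (simp add: subgroup.carrier_subgroup_generated_subgroup subgroup_loops)

sublocale L: comm_group L
  by (rule group.group_comm_groupI) (auto simp: loops_commute)

lemma loops_closed: "g \<in> loops b \<Longrightarrow> g \<in> carrier G"
  by (simp add: loops_def)

lemma inv_loops: "g \<in> loops b \<Longrightarrow> inv\<^bsub>L\<^esub> g = inv\<^bsub>G\<^esub> g"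
  using As.inv_subgroup_generated[of g "loops b"] by simp

lemma loops_mult: "\<lbrakk>g \<in> loops b; h \<in> loops b\<rbrakk> \<Longrightarrow> g \<otimes>\<^bsub>G\<^esub> h \<in> loops b"
  and loops_inv: "g \<in> loops b \<Longrightarrow> inv\<^bsub>G\<^esub> g \<in> loops b"
  using subgroup_loops[OF base] by (simp_all add: subgroup.m_closed subgroup.m_inv_closed)

section \<open>The 2-cocycle of a transversal\<close>

definition transversal :: "'a \<Rightarrow> ('a \<times> bool) list set" where
  "transversal x = (SOME g. g \<in> carrier G \<and> eps0 g = 0 \<and> act Q qop b g = x)"

lemma transversal:
  assumes "x \<in> Q"
  shows "transversal x \<in> carrier G" "eps0 (transversal x) = 0" "act Q qop b (transversal x) = x"
proof -
  have "\<exists>g. g \<in> carrier G \<and> eps0 g = 0 \<and> act Q qop b g = x"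
    using connected_degree_zero[OF connected base assms] by metis
  from someI_ex[OF this] show "transversal x \<in> carrier G" "eps0 (transversal x) = 0" "act Q qop b (transversal x) = x"
    by (simp_all add: transversal_def)
qed

definition cocycle :: "'a \<Rightarrow> 'a \<Rightarrow> ('a \<times> bool) list set" where
  "cocycle x y = transversal x \<otimes>\<^bsub>G\<^esub> gen y
     \<otimes>\<^bsub>G\<^esub> inv\<^bsub>G\<^esub> (transversal (qop x y)) \<otimes>\<^bsub>G\<^esub> inv\<^bsub>G\<^esub> (gen b)"

lemma cocycle_loops: "x \<in> Q \<Longrightarrow> y \<in> Q \<Longrightarrow> cocycle x y \<in> loops b"
proof -
  assume xy: "x \<in> Q" "y \<in> Q"
  then have "act Q qop (qop x y) (inv\<^bsub>G\<^esub> (transversal (qop x y))) = b"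
    by (intro act_inv) (simp_all add: transversal)
  then show ?thesis
    using xy by (simp add: cocycle_def loops_def transversal eps0_mult act_mult)
qed

lemma cocycle_closed [simp]: "x \<in> Q \<Longrightarrow> y \<in> Q \<Longrightarrow> cocycle x y \<in> carrier G"
  by (simp add: cocycle_loops loops_closed)

lemma transversal_gen:
  assumes "x \<in> Q" "y \<in> Q"
  shows "transversal x \<otimes>\<^bsub>G\<^esub> gen y = cocycle x y \<otimes>\<^bsub>G\<^esub> (gen b \<otimes>\<^bsub>G\<^esub> transversal (qop x y))"
  using assms by (simp add: cocycle_def transversal As.m_assoc)

text \<open>Two generators are moved past the transversal one after the other. The cocycle values
  are loops, so they commute with \<open>gen b\<close> and collect on the left.\<close>

lemma transversal_gen_gen:
  assumes "x \<in> Q" "y \<in> Q" "z \<in> Q"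
  shows "transversal x \<otimes>\<^bsub>G\<^esub> (gen y \<otimes>\<^bsub>G\<^esub> gen z) = (cocycle x y \<otimes>\<^bsub>G\<^esub> cocycle (qop x y) z) \<otimes>\<^bsub>G\<^esub>
    (gen b \<otimes>\<^bsub>G\<^esub> (gen b \<otimes>\<^bsub>G\<^esub> transversal (qop (qop x y) z)))"
proof -
  have "transversal x \<otimes>\<^bsub>G\<^esub> (gen y \<otimes>\<^bsub>G\<^esub> gen z)
      = cocycle x y \<otimes>\<^bsub>G\<^esub> (gen b \<otimes>\<^bsub>G\<^esub> (transversal (qop x y) \<otimes>\<^bsub>G\<^esub> gen z))"
    using assms transversal_gen[of x y]
    by (simp add: transversal cocycle_loops flip: As.m_assoc)
  also have "\<dots> = cocycle x y \<otimes>\<^bsub>G\<^esub> ((gen b \<otimes>\<^bsub>G\<^esub> cocycle (qop x y) z) \<otimes>\<^bsub>G\<^esub>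
      (gen b \<otimes>\<^bsub>G\<^esub> transversal (qop (qop x y) z)))"
    using assms by (simp add: transversal_gen transversal cocycle_loops As.m_assoc)
  finally show ?thesis
    using assms by (simp add: loop_commutes_gen transversal cocycle_loops As.m_assoc)
qed

text \<open>The products \<open>gen y\<close>, \<open>gen z\<close> and \<open>gen z\<close>,
  \<open>gen (qop y z)\<close> are the same element. Moving both past the transversal leads to the
  same end point by self-distributivity, and the common right factor cancels.\<close>

lemma cocycle_condition:
  assumes "x \<in> Q" "y \<in> Q" "z \<in> Q"
  shows "cocycle x y \<otimes>\<^bsub>G\<^esub> cocycle (qop x y) z = cocycle x z \<otimes>\<^bsub>G\<^esub> cocycle (qop x z) (qop y z)"
proof -
  have "gen z \<otimes>\<^bsub>G\<^esub> gen (qop y z) = gen y \<otimes>\<^bsub>G\<^esub> gen z"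
    using assms by (simp add: gen_op As.m_assoc)
  then show ?thesis
    using transversal_gen_gen[of x y z] transversal_gen_gen[of x z "qop y z"] assms
    by (simp add: op_distrib[of x y z] transversal cocycle_loops)
qed

text \<open>As \<open>transversal x\<close> carries \<open>b\<close> to \<open>x\<close>, it
  conjugates \<open>gen b\<close> into \<open>gen x\<close>.\<close>

lemma cocycle_diag:
  assumes "x \<in> Q"
  shows "cocycle x x = \<one>\<^bsub>G\<^esub>"
proof -
  have "gen x = inv\<^bsub>G\<^esub> (transversal x) \<otimes>\<^bsub>G\<^esub> (gen b \<otimes>\<^bsub>G\<^esub> transversal x)"
    using gen_act[of "transversal x" b] assms by (simp add: transversal As.m_assoc)
  then have "cocycle x x = transversal x \<otimes>\<^bsub>G\<^esub> (inv\<^bsub>G\<^esub> (transversal x) \<otimes>\<^bsub>G\<^esub> (gen b \<otimes>\<^bsub>G\<^esub> transversal x))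
      \<otimes>\<^bsub>G\<^esub> inv\<^bsub>G\<^esub> (transversal x) \<otimes>\<^bsub>G\<^esub> inv\<^bsub>G\<^esub> (gen b)"
    using assms by (simp add: cocycle_def)
  then show ?thesis
    using assms by (simp add: transversal As.m_assoc)
qed

text \<open>The linear extension of the cocycle. It exists by the universal property of the free
  Abelian group, because \<open>L\<close> is commutative.\<close>

definition loop_hom :: "('a list \<Rightarrow>\<^sub>0 int) \<Rightarrow> ('a \<times> bool) list set" where
  "loop_hom = (SOME \<phi>. \<phi> \<in> hom (CR 2 Q) L \<and> (\<forall>x\<in>Q. \<forall>y\<in>Q. \<phi> (frag_of [x, y]) = cocycle x y))"

lemma loop_hom:
  shows "loop_hom \<in> hom (CR 2 Q) L"
    and loop_hom_frag_of: "x \<in> Q \<Longrightarrow> y \<in> Q \<Longrightarrow> loop_hom (frag_of [x, y]) = cocycle x y"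
proof -
  have "(\<lambda>t. cocycle (hd t) (t ! 1)) ` tuples 2 Q \<subseteq> carrier L"
    by (auto simp: tuples_2 cocycle_loops)
  then obtain \<phi> where "\<phi> \<in> hom (CR 2 Q) L"
    "\<And>t. t \<in> tuples 2 Q \<Longrightarrow> \<phi> (frag_of t) = cocycle (hd t) (t ! 1)"
    by (rule L.free_Abelian_group_universal) blast
  then have "\<exists>\<phi>. \<phi> \<in> hom (CR 2 Q) L \<and> (\<forall>x\<in>Q. \<forall>y\<in>Q. \<phi> (frag_of [x, y]) = cocycle x y)"
    by (auto simp: pair_in_tuples)
  from someI_ex[OF this] show "loop_hom \<in> hom (CR 2 Q) L"
    "x \<in> Q \<Longrightarrow> y \<in> Q \<Longrightarrow> loop_hom (frag_of [x, y]) = cocycle x y"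
    by (simp_all add: loop_hom_def)
qed

sublocale \<phi>: group_hom "CR 2 Q" L loop_hom
  by (intro group_hom.intro group_hom_axioms.intro group_free_Abelian_group loop_hom L.is_group)

lemma loop_hom_loops [simp]: "Poly_Mapping.keys c \<subseteq> tuples 2 Q \<Longrightarrow> loop_hom c \<in> loops b"
  using \<phi>.hom_closed[of c] by simp

lemma loop_hom_closed [simp]: "Poly_Mapping.keys c \<subseteq> tuples 2 Q \<Longrightarrow> loop_hom c \<in> carrier G"
  by (simp add: loops_closed)

lemma loop_hom_0 [simp]: "loop_hom 0 = \<one>\<^bsub>G\<^esub>"
  using \<phi>.hom_one by simp

lemma loop_hom_add:
  assumes "Poly_Mapping.keys c \<subseteq> tuples 2 Q" "Poly_Mapping.keys d \<subseteq> tuples 2 Q"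
  shows "loop_hom (c + d) = loop_hom c \<otimes>\<^bsub>G\<^esub> loop_hom d"
  using \<phi>.hom_mult[of c d] assms by simp

lemma loop_hom_diff:
  assumes "Poly_Mapping.keys c \<subseteq> tuples 2 Q" "Poly_Mapping.keys d \<subseteq> tuples 2 Q"
  shows "loop_hom (c - d) = loop_hom c \<otimes>\<^bsub>G\<^esub> inv\<^bsub>G\<^esub> (loop_hom d)"
  using loop_hom_add[of c "- d"] \<phi>.hom_inv[of d] assms by (simp add: inv_loops)

text \<open>Degenerate pairs vanish by \<open>cocycle_diag\<close>, boundaries of triples by
  \<open>cocycle_condition\<close>.\<close>

lemma loop_hom_bounds:
  assumes "c \<in> bounds"
  shows "loop_hom c = \<one>\<^bsub>G\<^esub>"
proof -
  \<comment> \<open>The bound on the keys is carried along because \<open>loop_hom_diff\<close>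
    needs it for both terms.\<close>
  have "Poly_Mapping.keys c \<subseteq> tuples 2 Q \<and> loop_hom c = \<one>\<^bsub>G\<^esub>"
    using assms
  proof (induction rule: bounds_induct)
    case (boundary x y z)
    then have "cocycle (qop x y) z \<otimes>\<^bsub>G\<^esub> inv\<^bsub>G\<^esub> (cocycle x z) \<otimes>\<^bsub>G\<^esub>
        inv\<^bsub>G\<^esub> (cocycle (qop x z) (qop y z) \<otimes>\<^bsub>G\<^esub> inv\<^bsub>G\<^esub> (cocycle x y)) = \<one>\<^bsub>G\<^esub>"
      using L.mult_inv_mult_inv_eq_one[of "cocycle x y" "cocycle (qop x y) z" "cocycle x z"
          "cocycle (qop x z) (qop y z)"] cocycle_condition[of x y z]
      by (simp add: cocycle_loops inv_loops loops_mult loops_inv)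
    then show ?case
      using boundary by (simp add: bd_basis_3 keys_diffI pair_in_tuples loop_hom_diff loop_hom_frag_of)
  qed (auto simp: pair_in_tuples loop_hom_frag_of cocycle_diag loop_hom_diff keys_diffI)
  then show ?thesis ..
qed

text \<open>The letters are moved past the transversal one by one, each leaving a cocycle value and
  a power of \<open>gen b\<close>. For a closed path of degree 0 at \<open>b\<close>, this computes
  the class of the word from its chain.\<close>

lemma transversal_path:
  assumes "x \<in> Q" "w \<in> words Q"
  shows "transversal x \<otimes>\<^bsub>G\<^esub> cls w = loop_hom (path_chain x w) \<otimes>\<^bsub>G\<^esub>
    (gen b [^]\<^bsub>G\<^esub> word_deg w \<otimes>\<^bsub>G\<^esub> transversal (act_word Q qop x w))"
  using assms
proof (induction w arbitrary: x)
  case Nil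
  then show ?case by (simp add: transversal word_deg_def flip: one_As)
next
  case (Cons p w)
  obtain y s where p: "p = (y, s)" by force
  have y: "y \<in> Q" "w \<in> words Q" using Cons.prems p by simp_all
  show ?case
  proof (cases s)
    case True
    let ?x = "qop x y" and ?c = "path_chain (qop x y) w"
    have c: "Poly_Mapping.keys ?c \<subseteq> tuples 2 Q"
      using Cons.prems y by (simp add: path_chain_closed)
    have "transversal x \<otimes>\<^bsub>G\<^esub> cls (p # w) = transversal x \<otimes>\<^bsub>G\<^esub> gen y \<otimes>\<^bsub>G\<^esub> cls w"
      using Cons.prems y p True by (simp add: cls_Cons transversal As.m_assoc)
    also have "\<dots> = cocycle x y \<otimes>\<^bsub>G\<^esub> (gen b \<otimes>\<^bsub>G\<^esub> (transversal ?x \<otimes>\<^bsub>G\<^esub> cls w))"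
      using Cons.prems y by (simp add: transversal_gen transversal As.m_assoc)
    also have "\<dots> = cocycle x y \<otimes>\<^bsub>G\<^esub> (gen b \<otimes>\<^bsub>G\<^esub> loop_hom ?c) \<otimes>\<^bsub>G\<^esub>
        (gen b [^]\<^bsub>G\<^esub> word_deg w \<otimes>\<^bsub>G\<^esub> transversal (act_word Q qop ?x w))"
      using Cons y c by (simp add: transversal As.m_assoc)
    also have "\<dots> = cocycle x y \<otimes>\<^bsub>G\<^esub> loop_hom ?c \<otimes>\<^bsub>G\<^esub>
        (gen b [^]\<^bsub>G\<^esub> (1 + word_deg w) \<otimes>\<^bsub>G\<^esub> transversal (act_word Q qop ?x w))"
      using Cons.prems y c by (simp add: loop_commutes_gen transversal As.m_assoc As.int_pow_mult)
    finally show ?thesis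
      using Cons.prems y p c True
      by (simp add: loop_hom_add loop_hom_frag_of pair_in_tuples word_deg_def)
  next
    case False
    let ?x = "rinv x y" and ?c = "path_chain (rinv x y) w"
    have c: "Poly_Mapping.keys ?c \<subseteq> tuples 2 Q"
      using Cons.prems y by (simp add: path_chain_closed)
    have comm: "inv\<^bsub>G\<^esub> (gen b) \<otimes>\<^bsub>G\<^esub> g = g \<otimes>\<^bsub>G\<^esub> inv\<^bsub>G\<^esub> (gen b)" if "g \<in> loops b" for g
    proof -
      have "inv\<^bsub>G\<^esub> (gen b) \<otimes>\<^bsub>G\<^esub> (gen b \<otimes>\<^bsub>G\<^esub> g) \<otimes>\<^bsub>G\<^esub> inv\<^bsub>G\<^esub> (gen b)
          = inv\<^bsub>G\<^esub> (gen b) \<otimes>\<^bsub>G\<^esub> (g \<otimes>\<^bsub>G\<^esub> gen b) \<otimes>\<^bsub>G\<^esub> inv\<^bsub>G\<^esub> (gen b)"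
        using that by (simp add: loop_commutes_gen)
      then show ?thesis
        using loops_closed[OF that] by (simp add: As.m_assoc)
    qed
    \<comment> \<open>The relation for the edge from \<open>?x\<close> to \<open>x\<close> is read
      backwards, that is, solved for \<open>transversal x\<close>.\<close>
    have "transversal ?x \<otimes>\<^bsub>G\<^esub> gen y = cocycle ?x y \<otimes>\<^bsub>G\<^esub> gen b \<otimes>\<^bsub>G\<^esub> transversal x"
      using transversal_gen[of ?x y] Cons.prems y by (simp add: transversal As.m_assoc)
    then have "transversal x = inv\<^bsub>G\<^esub> (cocycle ?x y \<otimes>\<^bsub>G\<^esub> gen b) \<otimes>\<^bsub>G\<^esub> (transversal ?x \<otimes>\<^bsub>G\<^esub> gen y)"
      using Cons.prems y by (simp add: transversal As.inv_solve_left)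
    then have "transversal x \<otimes>\<^bsub>G\<^esub> inv\<^bsub>G\<^esub> (gen y) = inv\<^bsub>G\<^esub> (gen b) \<otimes>\<^bsub>G\<^esub> inv\<^bsub>G\<^esub> (cocycle ?x y) \<otimes>\<^bsub>G\<^esub> transversal ?x"
      using Cons.prems y by (simp add: transversal As.inv_mult_group As.m_assoc)
    then have "transversal x \<otimes>\<^bsub>G\<^esub> inv\<^bsub>G\<^esub> (gen y) \<otimes>\<^bsub>G\<^esub> cls w
        = inv\<^bsub>G\<^esub> (gen b) \<otimes>\<^bsub>G\<^esub> inv\<^bsub>G\<^esub> (cocycle ?x y) \<otimes>\<^bsub>G\<^esub> (transversal ?x \<otimes>\<^bsub>G\<^esub> cls w)"
      using Cons.prems y by (simp add: transversal As.m_assoc)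
    also have "\<dots> = inv\<^bsub>G\<^esub> (gen b) \<otimes>\<^bsub>G\<^esub> (inv\<^bsub>G\<^esub> (cocycle ?x y) \<otimes>\<^bsub>G\<^esub> loop_hom ?c) \<otimes>\<^bsub>G\<^esub>
        (gen b [^]\<^bsub>G\<^esub> word_deg w \<otimes>\<^bsub>G\<^esub> transversal (act_word Q qop ?x w))"
      using Cons y c by (simp add: transversal As.m_assoc)
    also have "\<dots> = (loop_hom ?c \<otimes>\<^bsub>G\<^esub> inv\<^bsub>G\<^esub> (cocycle ?x y)) \<otimes>\<^bsub>G\<^esub> (inv\<^bsub>G\<^esub> (gen b) \<otimes>\<^bsub>G\<^esub>
        (gen b [^]\<^bsub>G\<^esub> word_deg w \<otimes>\<^bsub>G\<^esub> transversal (act_word Q qop ?x w)))"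
      using Cons.prems y c
      by (simp add: comm loops_mult loops_inv cocycle_loops loops_commute[of "inv\<^bsub>G\<^esub> (cocycle ?x y)"]
          transversal As.m_assoc)
    also have "\<dots> = (loop_hom ?c \<otimes>\<^bsub>G\<^esub> inv\<^bsub>G\<^esub> (cocycle ?x y)) \<otimes>\<^bsub>G\<^esub>
        (gen b [^]\<^bsub>G\<^esub> (- 1 + word_deg w) \<otimes>\<^bsub>G\<^esub> transversal (act_word Q qop ?x w))"
      using Cons.prems y c As.int_pow_mult[of "gen b" "- 1" "word_deg w"]
        As.int_pow_neg[of "gen b" 1]
      by (simp add: transversal As.m_assoc)
    finally show ?thesis
      using Cons.prems y p c False
      by (simp add: cls_Cons transversal loop_hom_diff loop_hom_frag_of pair_in_tuples word_deg_def As.m_assoc)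
  qed
qed

section \<open>Recovering a chain from its loop\<close>

lemma class_chain_loop_mult:
  assumes "g \<in> loops b" "h \<in> carrier G"
  shows "class_chain b (g \<otimes>\<^bsub>G\<^esub> h) - (class_chain b g + class_chain b h) \<in> bounds"
  using class_chain_mult[of b g h] assms by (simp add: loops_def)

text \<open>Additivity on loops, applied to the product of \<open>g\<close> times the inverse of
  \<open>h\<close> with \<open>h\<close>.\<close>

lemma class_chain_loop_diff:
  assumes "g \<in> loops b" "h \<in> loops b"
  shows "class_chain b (g \<otimes>\<^bsub>G\<^esub> inv\<^bsub>G\<^esub> h) - (class_chain b g - class_chain b h) \<in> bounds"
proof -
  have "- (class_chain b (g \<otimes>\<^bsub>G\<^esub> inv\<^bsub>G\<^esub> h \<otimes>\<^bsub>G\<^esub> h) -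
      (class_chain b (g \<otimes>\<^bsub>G\<^esub> inv\<^bsub>G\<^esub> h) + class_chain b h)) \<in> bounds"
    using assms by (intro bounds_minus class_chain_loop_mult) (auto simp: loops_mult loops_inv loops_closed)
  then show ?thesis using assms by (simp add: As.m_assoc loops_closed algebra_simps)
qed

text \<open>The chains of the two sides of \<open>transversal_gen\<close> are compared; the factor
  \<open>gen b\<close> contributes only the degenerate pair \<open>[b, b]\<close>.\<close>

lemma class_chain_cocycle:
  assumes "x \<in> Q" "y \<in> Q"
  shows "class_chain b (cocycle x y) - (frag_of [x, y]
     - (class_chain b (transversal (qop x y)) - class_chain b (transversal x))) \<in> bounds"
  (is "_ - (_ - (?sxy - ?sx)) \<in> _")
proof -
  let ?bs = "gen b \<otimes>\<^bsub>G\<^esub> transversal (qop x y)"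
  have 1: "class_chain b (cocycle x y \<otimes>\<^bsub>G\<^esub> ?bs) - (class_chain b (cocycle x y) + class_chain b ?bs) \<in> bounds"
    using assms by (intro class_chain_loop_mult) (auto simp: cocycle_loops transversal)
  have 2: "class_chain b ?bs - (class_chain b (gen b) + ?sxy) \<in> bounds"
    using assms class_chain_mult[of b "gen b" "transversal (qop x y)"] by (simp add: transversal)
  have 3: "frag_of [b, b] - class_chain b (gen b) \<in> bounds" "frag_of [b, b] \<in> bounds"
    by (simp_all add: class_chain_gen degenerate_in_bounds)
  have 4: "class_chain b (transversal x \<otimes>\<^bsub>G\<^esub> gen y) - (?sx + class_chain x (gen y)) \<in> bounds"
    using assms class_chain_mult[of b "transversal x" "gen y"] by (simp add: transversal)
  have 5: "frag_of [x, y] - class_chain x (gen y) \<in> bounds"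
    using assms by (simp add: class_chain_gen)
  \<comment> \<open>In this combination of the relations above all auxiliary chains cancel.\<close>
  have "(class_chain b (transversal x \<otimes>\<^bsub>G\<^esub> gen y) - (?sx + class_chain x (gen y)))
      - (class_chain b (cocycle x y \<otimes>\<^bsub>G\<^esub> ?bs) - (class_chain b (cocycle x y) + class_chain b ?bs))
      - (class_chain b ?bs - (class_chain b (gen b) + ?sxy))
      - (frag_of [x, y] - class_chain x (gen y))
      + (frag_of [b, b] - class_chain b (gen b)) - frag_of [b, b] \<in> bounds"
    by (intro bounds_diff[OF bounds_add[OF bounds_diff[OF bounds_diff[OF bounds_diff]]]] 1 2 3 4 5)
  then show ?thesis
    using assms by (simp add: transversal_gen algebra_simps)
qed

text \<open>The transversal terms of \<open>class_chain_cocycle\<close> depend linearly on the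
  boundary of the pair, so they extend to a correction that depends only on \<open>bd qop c\<close>.
  It vanishes on cycles, where \<open>class_chain b\<close> therefore inverts
  \<open>loop_hom\<close> modulo boundaries.\<close>

lemma class_chain_loop_hom:
  assumes "Poly_Mapping.keys c \<subseteq> tuples 2 Q"
  shows "class_chain b (loop_hom c)
    - (c - frag_extend (\<lambda>t. class_chain b (transversal (hd t))) (bd qop c)) \<in> bounds"
    (is "_ - (_ - ?\<sigma> (bd qop c)) \<in> _")
proof -
  have "Poly_Mapping.keys c \<subseteq> tuples 2 Q \<and> class_chain b (loop_hom c) - (c - ?\<sigma> (bd qop c)) \<in> bounds"
    using assms
  proof (induction rule: frag_induction)
    case zero
    \<comment> \<open>Since the identity is its own square, this element is just
      \<open>class_chain b\<close> of the identity.\<close>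
    have "- (class_chain b (\<one>\<^bsub>G\<^esub> \<otimes>\<^bsub>G\<^esub> \<one>\<^bsub>G\<^esub>) - (class_chain b \<one>\<^bsub>G\<^esub> + class_chain b \<one>\<^bsub>G\<^esub>)) \<in> bounds"
      by (intro bounds_minus class_chain_loop_mult) (auto simp: subgroup.one_closed[OF subgroup_loops])
    then show ?case by simp
  next
    case (one t)
    then show ?case
      using class_chain_cocycle
      by (auto simp: tuples_2 loop_hom_frag_of bd_basis_2 frag_extend_diff)
  next
    case (diff c d)
    have "class_chain b (loop_hom c \<otimes>\<^bsub>G\<^esub> inv\<^bsub>G\<^esub> (loop_hom d))
        - (class_chain b (loop_hom c) - class_chain b (loop_hom d))
        + ((class_chain b (loop_hom c) - (c - ?\<sigma> (bd qop c)))
        - (class_chain b (loop_hom d) - (d - ?\<sigma> (bd qop d)))) \<in> bounds"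
      using diff by (intro bounds_add[OF class_chain_loop_diff bounds_diff]) auto
    then show ?case
      using diff by (simp add: loop_hom_diff keys_diffI bd_diff frag_extend_diff algebra_simps)
  qed
  then show ?thesis ..
qed

section \<open>The isomorphism between second homology and loops\<close>

lemma subgroup_qcycles: "subgroup (qcycles 2 Q qop) (CR 2 Q)"
proof (rule group.subgroupI[OF group_free_Abelian_group])
  show "qcycles 2 Q qop \<noteq> {}"
    by (auto simp: qcycles_2 intro!: exI[of _ 0])
next
  fix c d assume "c \<in> qcycles 2 Q qop" "d \<in> qcycles 2 Q qop"
  then show "c \<otimes>\<^bsub>CR 2 Q\<^esub> d \<in> qcycles 2 Q qop"
    by (simp add: qcycles_2 bd_add keys_addI)
next
  fix c assume "c \<in> qcycles 2 Q qop"
  then show "inv\<^bsub>CR 2 Q\<^esub> c \<in> qcycles 2 Q qop"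
    using bd_diff[of qop 0 c] by (simp add: qcycles_2)
qed (auto simp: qcycles_2)

lemma carrier_cycle_group:
  "carrier (subgroup_generated (CR 2 Q) (qcycles 2 Q qop)) = qcycles 2 Q qop"
  by (rule subgroup.carrier_subgroup_generated_subgroup[OF subgroup_qcycles])

lemma loop_hom_image: "loop_hom ` qcycles 2 Q qop = loops b"
proof
  show "loop_hom ` qcycles 2 Q qop \<subseteq> loops b"
    by (auto simp: qcycles_2)
  show "loops b \<subseteq> loop_hom ` qcycles 2 Q qop"
  proof
    fix z assume z: "z \<in> loops b"
    then obtain w where w: "w \<in> words Q" "z = cls w"
      by (auto simp: loops_def carrier_As)
    let ?c = "path_chain b w"
    have w': "act_word Q qop b w = b" "word_deg w = 0"
      using z w by (simp_all add: loops_def act_cls eps0_cls)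
    have c: "Poly_Mapping.keys ?c \<subseteq> tuples 2 Q" "bd qop ?c = 0"
      using w w' by (simp_all add: path_chain_closed bd_path_chain)
    \<comment> \<open>The chosen \<open>transversal b\<close> may differ from the identity, but it
      is a loop, hence commutes with \<open>z\<close> and cancels.\<close>
    have s: "transversal b \<in> loops b"
      by (simp add: loops_def transversal)
    have "z \<otimes>\<^bsub>G\<^esub> transversal b = loop_hom ?c \<otimes>\<^bsub>G\<^esub> transversal b"
      using transversal_path[of b w] loops_commute[OF s z] w w' s by (simp add: transversal)
    then have "z = loop_hom ?c"
      using z s c by (simp add: loops_closed)
    then show "z \<in> loop_hom ` qcycles 2 Q qop"
      using c by (auto simp: qcycles_2)
  qed
qed

lemma loop_hom_kernel:
  assumes "c \<in> qcycles 2 Q qop"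
  shows "loop_hom c = \<one>\<^bsub>G\<^esub> \<longleftrightarrow> c \<in> bounds"
proof
  have c: "Poly_Mapping.keys c \<subseteq> tuples 2 Q" "bd qop c = 0"
    using assms by (simp_all add: qcycles_2)
  have 0: "class_chain b \<one>\<^bsub>G\<^esub> \<in> bounds"
    using class_chain_loop_hom[of 0] by simp
  assume "loop_hom c = \<one>\<^bsub>G\<^esub>"
  then have "class_chain b \<one>\<^bsub>G\<^esub> - c \<in> bounds"
    using class_chain_loop_hom[OF c(1)] c by simp
  then show "c \<in> bounds"
    using bounds_diff[OF 0] by fastforce
qed (rule loop_hom_bounds)

text \<open>The first isomorphism theorem for \<open>loop_hom\<close> restricted to cycles.\<close>

theorem HQ_2_iso_loops: "group (HQ 2 Q qop)" "HQ 2 Q qop \<cong> subgroup_generated G (loops b)"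
proof -
  let ?Z = "subgroup_generated (CR 2 Q) (qcycles 2 Q qop)"
  interpret Z: group_hom ?Z L loop_hom
  proof (intro group_hom.intro group_hom_axioms.intro)
    show "group ?Z" by (simp add: group.group_subgroup_generated)
    show "loop_hom \<in> hom ?Z L"
      using loop_hom(1) by (rule group.hom_from_subgroup_generated[OF group_free_Abelian_group])
  qed (rule L.is_group)
  have kernel: "kernel ?Z L loop_hom = bounds"
    unfolding kernel_def carrier_cycle_group
    using loop_hom_kernel bounds_chain bd_bounds by (auto simp: qcycles_2)
  have "bounds \<lhd> ?Z"
    using Z.normal_kernel unfolding kernel .
  then show "group (HQ 2 Q qop)"
    unfolding HQ_def by (rule normal.factorgroup_is_group)
  have "(\<lambda>A. the_elem (loop_hom ` A)) \<in> iso (?Z Mod bounds) L"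
    using Z.FactGroup_iso_set unfolding kernel by (simp add: carrier_cycle_group loop_hom_image)
  then show "HQ 2 Q qop \<cong> L"
    unfolding HQ_def by (rule is_isoI)
qed

end

section \<open>The extended quandle\<close>

context quandle_on
begin

text \<open>By \<open>gen_act\<close>, conjugation by \<open>g\<close> fixes every
  generator.\<close>

lemma acts_trivially_central:
  assumes "g \<in> carrier G" "\<And>x. x \<in> Q \<Longrightarrow> act Q qop x g = x" "h \<in> carrier G"
  shows "g \<otimes>\<^bsub>G\<^esub> h = h \<otimes>\<^bsub>G\<^esub> g"
  using assms(3)
proof (induction rule: As_induct)
  have comm: "g \<otimes>\<^bsub>G\<^esub> gen y = gen y \<otimes>\<^bsub>G\<^esub> g" if "y \<in> Q" for y
  proof -
    have "g \<otimes>\<^bsub>G\<^esub> gen y = g \<otimes>\<^bsub>G\<^esub> (inv\<^bsub>G\<^esub> g \<otimes>\<^bsub>G\<^esub> gen y \<otimes>\<^bsub>G\<^esub> g)"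
      using gen_act[of g y] assms that by simp
    then show ?thesis using assms that by (simp add: As.m_assoc)
  qed
  {
    case (mult h y)
    have "g \<otimes>\<^bsub>G\<^esub> (h \<otimes>\<^bsub>G\<^esub> gen y) = h \<otimes>\<^bsub>G\<^esub> (g \<otimes>\<^bsub>G\<^esub> gen y)"
      using mult assms by (simp flip: As.m_assoc)
    then show ?case using mult assms by (simp add: comm As.m_assoc)
  next
    case (mult_inv h y)
    have "inv\<^bsub>G\<^esub> (gen y) \<otimes>\<^bsub>G\<^esub> (gen y \<otimes>\<^bsub>G\<^esub> g) \<otimes>\<^bsub>G\<^esub> inv\<^bsub>G\<^esub> (gen y)
        = inv\<^bsub>G\<^esub> (gen y) \<otimes>\<^bsub>G\<^esub> (g \<otimes>\<^bsub>G\<^esub> gen y) \<otimes>\<^bsub>G\<^esub> inv\<^bsub>G\<^esub> (gen y)"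
      using mult_inv by (simp add: comm)
    then have "g \<otimes>\<^bsub>G\<^esub> inv\<^bsub>G\<^esub> (gen y) = inv\<^bsub>G\<^esub> (gen y) \<otimes>\<^bsub>G\<^esub> g"
      using mult_inv assms by (simp add: As.m_assoc)
    moreover have "g \<otimes>\<^bsub>G\<^esub> (h \<otimes>\<^bsub>G\<^esub> inv\<^bsub>G\<^esub> (gen y)) = h \<otimes>\<^bsub>G\<^esub> (g \<otimes>\<^bsub>G\<^esub> inv\<^bsub>G\<^esub> (gen y))"
      using mult_inv assms by (simp flip: As.m_assoc)
    ultimately show ?case using mult_inv assms by (simp add: As.m_assoc)
  }
qed (use assms in simp)

lemma act_gen_pow:
  "x \<in> Q \<Longrightarrow> y \<in> Q \<Longrightarrow> act Q qop x (gen y [^]\<^bsub>G\<^esub> (n::nat)) = ((\<lambda>z. qop z y) ^^ n) x"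
proof (induction n)
  case (Suc n)
  show ?case using Suc.prems by (simp add: act_mult Suc.IH[OF Suc.prems, symmetric])
qed simp

lemma eps0_nat_pow: "g \<in> carrier G \<Longrightarrow> eps0 (g [^]\<^bsub>G\<^esub> (n::nat)) = int n * eps0 g"
  by (induction n) (simp_all add: eps0_mult algebra_simps)

lemma gen_pow_central:
  assumes "x \<in> Q" "\<And>z. z \<in> Q \<Longrightarrow> act Q qop z (gen x [^]\<^bsub>G\<^esub> (n::nat)) = z" "h \<in> carrier G"
  shows "gen x [^]\<^bsub>G\<^esub> n \<otimes>\<^bsub>G\<^esub> h = h \<otimes>\<^bsub>G\<^esub> gen x [^]\<^bsub>G\<^esub> n"
  using assms by (intro acts_trivially_central) auto

text \<open>Connectedness makes the two generators conjugate, hence also their \<open>n\<close>-th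
  powers, and the power of \<open>gen x\<close> is central.\<close>

lemma gen_pow_const:
  assumes "quandle_connected Q qop" "x \<in> Q" "y \<in> Q"
    and "\<And>z. z \<in> Q \<Longrightarrow> act Q qop z (gen x [^]\<^bsub>G\<^esub> (n::nat)) = z"
  shows "gen y [^]\<^bsub>G\<^esub> n = gen x [^]\<^bsub>G\<^esub> n"
proof -
  obtain g where g: "g \<in> carrier G" "act Q qop x g = y"
    using assms unfolding quandle_connected_def by blast
  have "(inv\<^bsub>G\<^esub> g \<otimes>\<^bsub>G\<^esub> gen x \<otimes>\<^bsub>G\<^esub> g) [^]\<^bsub>G\<^esub> k = inv\<^bsub>G\<^esub> g \<otimes>\<^bsub>G\<^esub> gen x [^]\<^bsub>G\<^esub> k \<otimes>\<^bsub>G\<^esub> g" for k :: nat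
    using g assms by (induction k) (simp_all add: As.m_assoc)
  then have "gen y [^]\<^bsub>G\<^esub> n = inv\<^bsub>G\<^esub> g \<otimes>\<^bsub>G\<^esub> (gen x [^]\<^bsub>G\<^esub> n \<otimes>\<^bsub>G\<^esub> g)"
    using g gen_act[of g x] assms by (simp add: As.m_assoc)
  then show ?thesis
    using g assms by (simp add: gen_pow_central)
qed

end

locale connected_quandle = quandle_on Q qop
  for Q :: "'a set" and qop :: "'a \<Rightarrow> 'a \<Rightarrow> 'a" +
  fixes a :: 'a
  assumes base [simp]: "a \<in> Q" and connected: "quandle_connected Q qop"
begin

abbreviation Xt where "Xt \<equiv> ext_carrier Q qop"
abbreviation xop where "xop \<equiv> ext_op Q qop a"
abbreviation p where "p \<equiv> cover Q qop a"
abbreviation p_map where "p_map \<equiv> cover_hom Q qop a"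

lemma in_Xt: "g \<in> Xt \<longleftrightarrow> g \<in> carrier G \<and> eps0 g = 0"
  by (simp add: ext_carrier_def)

lemma Xt_closed [simp]: "g \<in> Xt \<Longrightarrow> g \<in> carrier G"
  by (simp add: in_Xt)

lemma xop_eq:
  "g \<in> Xt \<Longrightarrow> h \<in> Xt \<Longrightarrow> xop g h =
    inv\<^bsub>G\<^esub> (gen a) \<otimes>\<^bsub>G\<^esub> (g \<otimes>\<^bsub>G\<^esub> (inv\<^bsub>G\<^esub> h \<otimes>\<^bsub>G\<^esub> (gen a \<otimes>\<^bsub>G\<^esub> h)))"
  by (simp add: ext_op_def As.m_assoc)

lemma xop_closed: "g \<in> Xt \<Longrightarrow> h \<in> Xt \<Longrightarrow> xop g h \<in> Xt"
  by (simp add: xop_eq) (simp add: in_Xt eps0_mult del: Xt_closed)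

lemma quandle_ext: "quandle Xt xop"
  unfolding quandle_def
proof (intro conjI ballI)
  fix g assume g: "g \<in> Xt"
  show "xop g g = g" using g by (simp add: xop_eq)
  \<comment> \<open>Obtained by solving \<open>xop k g = h\<close> for \<open>k\<close>.\<close>
  let ?inv = "\<lambda>h. gen a \<otimes>\<^bsub>G\<^esub> (h \<otimes>\<^bsub>G\<^esub> (inv\<^bsub>G\<^esub> g \<otimes>\<^bsub>G\<^esub> (inv\<^bsub>G\<^esub> (gen a) \<otimes>\<^bsub>G\<^esub> g)))"
  have closed: "?inv h \<in> Xt" if "h \<in> Xt" for h
    using that g by (simp add: in_Xt eps0_mult del: Xt_closed)
  show "bij_betw (\<lambda>h. xop h g) Xt Xt"
  proof (rule bij_betwI[where g = ?inv])
    show "?inv (xop h g) = h" if "h \<in> Xt" for h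
      using that g by (simp add: xop_eq As.m_assoc)
    show "xop (?inv h) g = h" if "h \<in> Xt" for h
      using that g xop_eq[OF closed[OF that] g] by (simp add: As.m_assoc)
  qed (use g xop_closed closed in auto)
next
  fix g h k assume ghk: "g \<in> Xt" "h \<in> Xt" "k \<in> Xt"
  then show "xop (xop g h) k = xop (xop g k) (xop h k)"
    \<comment> \<open>The outer operations are unfolded first, while their arguments still have the
      form to which \<open>xop_closed\<close> applies.\<close>
    by (simp add: xop_eq[OF xop_closed xop_closed] xop_eq[OF xop_closed])
       (simp add: xop_eq As.inv_mult_group As.m_assoc)
qed (rule xop_closed)

sublocale E: quandle_on Xt xop
  by (rule quandle_on.intro) (rule quandle_ext)

section \<open>The covering and its induced homomorphism\<close>

lemma p_closed [simp]: "g \<in> Xt \<Longrightarrow> p g \<in> Q"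
  by (simp add: cover_def)

lemma gen_p: "g \<in> Xt \<Longrightarrow> gen (p g) = inv\<^bsub>G\<^esub> g \<otimes>\<^bsub>G\<^esub> (gen a \<otimes>\<^bsub>G\<^esub> g)"
  by (simp add: cover_def gen_act As.m_assoc)

text \<open>Up to a left factor \<open>gen a\<close>, which fixes \<open>a\<close>, the operation by
  \<open>h\<close> is right multiplication by \<open>gen (p h)\<close>.\<close>

lemma p_xop:
  assumes "g \<in> Xt" "h \<in> Xt"
  shows "p (xop g h) = qop (p g) (p h)"
proof -
  have "xop g h = inv\<^bsub>G\<^esub> (gen a) \<otimes>\<^bsub>G\<^esub> (g \<otimes>\<^bsub>G\<^esub> gen (p h))"
    using assms by (simp add: xop_eq gen_p)
  then show ?thesis
    using assms by (simp add: cover_def act_mult)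
qed

lemma p_surj:
  assumes "y \<in> Q"
  obtains g where "g \<in> Xt" "p g = y"
  using connected_degree_zero[OF connected base assms] by (auto simp: in_Xt cover_def simp del: Xt_closed)

abbreviation p_word where "p_word \<equiv> map (\<lambda>(g, s). (p g, s))"

lemma p_word_words [simp]: "w \<in> words Xt \<Longrightarrow> p_word w \<in> words Q"
  by (induction w) auto

lemma p_word_cong: "as_eq Xt xop u v \<Longrightarrow> as_eq Q qop (p_word u) (p_word v)"
proof (induction rule: as_eq.induct)
  case (as_cancel u v x b)
  then show ?case using as_eq.as_cancel[of "p_word u" Q "p_word v" "p x" qop b] by simp
next
  case (as_rel u v x y)
  then show ?case using as_eq.as_rel[of "p_word u" Q "p_word v" "p x" "p y" qop] by (simp add: p_xop)
qed (auto intro: as_eq.intros)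

lemma p_map_cls: "w \<in> words Xt \<Longrightarrow> p_map (E.cls w) = cls (p_word w)"
  unfolding cover_hom_def using p_word_cong[OF E.some_rep, of w] cls_eq_iff[of "p_word w"]
  by (intro sym[of "cls (p_word w)"]) simp

sublocale P: group_hom E.G G p_map
proof (intro group_hom.intro group_hom_axioms.intro homI)
  fix x y assume "x \<in> carrier E.G" "y \<in> carrier E.G"
  then show "p_map (x \<otimes>\<^bsub>E.G\<^esub> y) = p_map x \<otimes>\<^bsub>G\<^esub> p_map y"
    by (auto simp: E.carrier_As p_map_cls simp flip: E.cls_append cls_append)
qed (auto simp: E.carrier_As p_map_cls)

lemma p_map_gen [simp]: "g \<in> Xt \<Longrightarrow> p_map (E.gen g) = gen (p g)"
  using p_map_cls[of "[(g, True)]"] by (simp add: as_gen_def)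

lemma eps0_p_map: "x \<in> carrier E.G \<Longrightarrow> eps0 (p_map x) = eps0 x"
  by (induction rule: E.As_induct) (simp_all add: eps0_mult E.eps0_mult)

text \<open>A generator \<open>E.gen h\<close> multiplies by \<open>gen (p h)\<close> on the right
  and by the inverse of \<open>gen a\<close> on the left; the left factors add up to the
  degree.\<close>

lemma E_act:
  assumes "x \<in> carrier E.G" "g \<in> Xt"
  shows "act Xt xop g x = gen a [^]\<^bsub>G\<^esub> (- eps0 x) \<otimes>\<^bsub>G\<^esub> (g \<otimes>\<^bsub>G\<^esub> p_map x)"
  using assms
proof (induction rule: E.As_induct)
  case one
  then show ?case by simp
next
  case (mult x h)
  have "gen a [^]\<^bsub>G\<^esub> (- eps0 x - 1) = inv\<^bsub>G\<^esub> (gen a) \<otimes>\<^bsub>G\<^esub> gen a [^]\<^bsub>G\<^esub> (- eps0 x)"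
    using As.int_pow_mult[of "gen a" "- 1" "- eps0 x"] As.int_pow_neg[of "gen a" 1]
    by (simp add: minus_diff_commute)
  moreover have "act Xt xop g x \<in> Xt"
    using mult E.act_closed by blast
  ultimately show ?case
    using mult by (simp add: E.act_mult xop_eq E.eps0_mult gen_p As.m_assoc)
next
  case (mult_inv x h)
  \<comment> \<open>The value that the formula predicts. Operating on it by \<open>h\<close> gives
    back the previous point, which identifies it as the image under the inverse translation.\<close>
  let ?r = "gen a [^]\<^bsub>G\<^esub> (1 - eps0 x) \<otimes>\<^bsub>G\<^esub> (g \<otimes>\<^bsub>G\<^esub> (p_map x \<otimes>\<^bsub>G\<^esub> inv\<^bsub>G\<^esub> (gen (p h))))"
  have r: "?r \<in> Xt"
    using mult_inv by (simp add: in_Xt eps0_mult eps0_int_pow eps0_p_map del: Xt_closed)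
  have "gen a [^]\<^bsub>G\<^esub> (- eps0 x) = inv\<^bsub>G\<^esub> (gen a) \<otimes>\<^bsub>G\<^esub> gen a [^]\<^bsub>G\<^esub> (1 - eps0 x)"
    using As.int_pow_mult[of "gen a" "- 1" "1 - eps0 x"] As.int_pow_neg[of "gen a" 1] by simp
  then have "xop ?r h = act Xt xop g x"
    using mult_inv r xop_eq[OF r, of h]
    by (simp add: gen_p As.inv_mult_group As.m_assoc)
  then have "E.rinv (act Xt xop g x) h = ?r"
    using E.rinv_op[OF r] mult_inv by metis
  moreover have "act Xt xop g x \<in> Xt"
    using mult_inv E.act_closed by blast
  then have "act Xt xop g (x \<otimes>\<^bsub>E.G\<^esub> inv\<^bsub>E.G\<^esub> (E.gen h)) = E.rinv (act Xt xop g x) h"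
    using mult_inv by (simp only: E.act_mult E.gen_closed E.As.inv_closed E.act_inv_gen)
  ultimately show ?case
    using mult_inv by (simp add: E.eps0_mult)
qed

lemma p_map_surj: "g \<in> carrier G \<Longrightarrow> \<exists>x\<in>carrier E.G. p_map x = g"
proof (induction rule: As_induct)
  case one
  then show ?case using P.hom_one by blast
next
  case (mult g y)
  then obtain x h where "x \<in> carrier E.G" "p_map x = g" "h \<in> Xt" "p h = y"
    using p_surj by metis
  then show ?case by (intro bexI[of _ "x \<otimes>\<^bsub>E.G\<^esub> E.gen h"]) auto
next
  case (mult_inv g y)
  then obtain x h where "x \<in> carrier E.G" "p_map x = g" "h \<in> Xt" "p h = y"
    using p_surj by metis
  then show ?case by (intro bexI[of _ "x \<otimes>\<^bsub>E.G\<^esub> inv\<^bsub>E.G\<^esub> (E.gen h)"]) auto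
qed

text \<open>In degree 0 the action is right multiplication by \<open>p_map x\<close>, so a lift of
  the quotient of \<open>g\<close> and \<open>h\<close> moves \<open>g\<close> to \<open>h\<close>;
  it has degree 0 because \<open>p_map\<close> preserves degrees.\<close>

lemma connected_ext: "quandle_connected Xt xop"
  unfolding quandle_connected_def
proof (intro ballI)
  fix g h assume gh: "g \<in> Xt" "h \<in> Xt"
  then obtain x where x: "x \<in> carrier E.G" "p_map x = inv\<^bsub>G\<^esub> g \<otimes>\<^bsub>G\<^esub> h"
    using p_map_surj[of "inv\<^bsub>G\<^esub> g \<otimes>\<^bsub>G\<^esub> h"] by auto
  then have "eps0 x = 0"
    using eps0_p_map[OF x(1)] gh by (simp add: eps0_mult in_Xt del: Xt_closed)
  then have "act Xt xop g x = h"
    using gh x by (simp add: E_act)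
  then show "\<exists>x\<in>carrier E.G. act Xt xop g x = h" using x by blast
qed

lemma one_in_Xt [simp]: "\<one>\<^bsub>G\<^esub> \<in> Xt"
  by (simp add: in_Xt del: Xt_closed)

text \<open>An \<open>x\<close> of degree 0 moves the identity to \<open>p_map x\<close>, and
  elements of the kernel have degree 0.\<close>

lemma loops_eq_kernel: "E.loops \<one>\<^bsub>G\<^esub> = kernel E.G G p_map"
  using eps0_p_map by (fastforce simp: E.loops_def kernel_def E_act)

lemma kernel_acts_trivially:
  assumes "x \<in> kernel E.G G p_map" "g \<in> Xt"
  shows "act Xt xop g x = g"
  using assms eps0_p_map[of x] by (simp add: kernel_def E_act)

lemma kernel_central:
  assumes "x \<in> kernel E.G G p_map" "y \<in> carrier E.G"
  shows "x \<otimes>\<^bsub>E.G\<^esub> y = y \<otimes>\<^bsub>E.G\<^esub> x"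
  using assms by (intro E.acts_trivially_central kernel_acts_trivially) (auto simp: kernel_def)

sublocale Y: pointed_quandle Xt xop "\<one>\<^bsub>G\<^esub>"
proof unfold_locales
  fix g h assume "g \<in> E.loops \<one>\<^bsub>G\<^esub>" "h \<in> E.loops \<one>\<^bsub>G\<^esub>"
  then show "g \<otimes>\<^bsub>E.G\<^esub> h = h \<otimes>\<^bsub>E.G\<^esub> g"
    unfolding loops_eq_kernel by (intro kernel_central) (auto simp: kernel_def)
qed (simp_all add: connected_ext)

end

section \<open>Torsion of the kernel\<close>

context connected_quandle
begin

lemma HQ_2_ext_iso: "HQ 2 Xt xop \<cong> subgroup_generated E.G (kernel E.G G p_map)"
  using Y.HQ_2_iso_loops(2) by (simp add: loops_eq_kernel)

text \<open>The power has degree \<open>n\<close> and image \<open>gen a\<close> to the power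
  \<open>n\<close>, so by \<open>E_act\<close> it acts as conjugation by that central
  element.\<close>

lemma E_gen_pow_acts_trivially:
  assumes n: "\<And>x y. \<lbrakk>x \<in> Q; y \<in> Q\<rbrakk> \<Longrightarrow> ((\<lambda>z. qop z y) ^^ n) x = x"
    and "g \<in> Xt" "h \<in> Xt"
  shows "act Xt xop g (E.gen h [^]\<^bsub>E.G\<^esub> n) = g"
proof -
  have trivial: "act Q qop x (gen a [^]\<^bsub>G\<^esub> n) = x" if "x \<in> Q" for x
    using that n by (simp add: act_gen_pow)
  have "p_map (E.gen h [^]\<^bsub>E.G\<^esub> n) = gen a [^]\<^bsub>G\<^esub> n"
    using assms gen_pow_const[OF connected base p_closed[OF assms(3)] trivial] by (simp add: P.hom_nat_pow)
  then have "act Xt xop g (E.gen h [^]\<^bsub>E.G\<^esub> n)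
      = inv\<^bsub>G\<^esub> (gen a [^]\<^bsub>G\<^esub> n) \<otimes>\<^bsub>G\<^esub> (g \<otimes>\<^bsub>G\<^esub> gen a [^]\<^bsub>G\<^esub> n)"
    using assms by (simp add: E_act E.eps0_nat_pow As.int_pow_neg int_pow_int)
  also have "\<dots> = inv\<^bsub>G\<^esub> (gen a [^]\<^bsub>G\<^esub> n) \<otimes>\<^bsub>G\<^esub> (gen a [^]\<^bsub>G\<^esub> n \<otimes>\<^bsub>G\<^esub> g)"
    using assms gen_pow_central[OF base trivial, of g] by simp
  finally show ?thesis using assms by simp
qed

definition torsion :: "nat \<Rightarrow> (('a \<times> bool) list set \<times> bool) list set set" where
  "torsion n = {x \<in> kernel E.G G p_map. x [^]\<^bsub>E.G\<^esub> n = \<one>\<^bsub>E.G\<^esub>}"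

text \<open>Congruence modulo the central subgroup \<open>torsion n\<close>, kept as a relation in
  place of a quotient group.\<close>

definition tors_eq where
  "tors_eq n x y \<longleftrightarrow> y \<in> carrier E.G \<and> (\<exists>k\<in>torsion n. x = k \<otimes>\<^bsub>E.G\<^esub> y)"

lemma torsion_closed: "k \<in> torsion n \<Longrightarrow> k \<in> carrier E.G"
  by (simp add: torsion_def kernel_def)

lemma torsion_central:
  "k \<in> torsion n \<Longrightarrow> y \<in> carrier E.G \<Longrightarrow> k \<otimes>\<^bsub>E.G\<^esub> y = y \<otimes>\<^bsub>E.G\<^esub> k"
  unfolding torsion_def using kernel_central by blast

lemma torsion_one: "\<one>\<^bsub>E.G\<^esub> \<in> torsion n"
  by (simp add: torsion_def kernel_def)

lemma torsion_mult:
  assumes "k \<in> torsion n" "l \<in> torsion n"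
  shows "k \<otimes>\<^bsub>E.G\<^esub> l \<in> torsion n"
  using assms torsion_central[OF assms(1) torsion_closed[OF assms(2)]]
  by (simp add: torsion_def kernel_def E.As.pow_mult_distrib)

lemma torsion_inv: "k \<in> torsion n \<Longrightarrow> inv\<^bsub>E.G\<^esub> k \<in> torsion n"
  by (simp add: torsion_def kernel_def E.As.nat_pow_inv)

lemma tors_eq_refl: "x \<in> carrier E.G \<Longrightarrow> tors_eq n x x"
  unfolding tors_eq_def by (auto intro!: bexI[OF _ torsion_one])

lemma tors_eq_sym: "tors_eq n x y \<Longrightarrow> tors_eq n y x"
  unfolding tors_eq_def using torsion_closed torsion_inv
  by (metis E.As.inv_mult_cancel_left E.As.m_closed)

lemma tors_eq_trans: "tors_eq n x y \<Longrightarrow> tors_eq n y z \<Longrightarrow> tors_eq n x z"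
  unfolding tors_eq_def using torsion_closed torsion_mult E.As.m_assoc by metis

lemma tors_eq_mult:
  assumes "tors_eq n x y" "tors_eq n x' y'"
  shows "tors_eq n (x \<otimes>\<^bsub>E.G\<^esub> x') (y \<otimes>\<^bsub>E.G\<^esub> y')"
proof -
  obtain k k' where k: "k \<in> torsion n" "x = k \<otimes>\<^bsub>E.G\<^esub> y" "k' \<in> torsion n" "x' = k' \<otimes>\<^bsub>E.G\<^esub> y'"
    and y: "y \<in> carrier E.G" "y' \<in> carrier E.G"
    using assms by (auto simp: tors_eq_def)
  have "x \<otimes>\<^bsub>E.G\<^esub> x' = k \<otimes>\<^bsub>E.G\<^esub> ((y \<otimes>\<^bsub>E.G\<^esub> k') \<otimes>\<^bsub>E.G\<^esub> y')"
    using k y by (simp add: torsion_closed E.As.m_assoc)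
  also have "\<dots> = k \<otimes>\<^bsub>E.G\<^esub> ((k' \<otimes>\<^bsub>E.G\<^esub> y) \<otimes>\<^bsub>E.G\<^esub> y')"
    using torsion_central[OF k(3) y(1)] by simp
  also have "\<dots> = (k \<otimes>\<^bsub>E.G\<^esub> k') \<otimes>\<^bsub>E.G\<^esub> (y \<otimes>\<^bsub>E.G\<^esub> y')"
    using k y by (simp add: torsion_closed E.As.m_assoc)
  finally show ?thesis
    unfolding tors_eq_def using k y by (auto intro!: bexI[OF _ torsion_mult])
qed

lemma tors_eq_inv:
  assumes "tors_eq n x y"
  shows "tors_eq n (inv\<^bsub>E.G\<^esub> x) (inv\<^bsub>E.G\<^esub> y)"
proof -
  obtain k where k: "k \<in> torsion n" "x = k \<otimes>\<^bsub>E.G\<^esub> y" "y \<in> carrier E.G"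
    using assms by (auto simp: tors_eq_def)
  then have "inv\<^bsub>E.G\<^esub> x = inv\<^bsub>E.G\<^esub> k \<otimes>\<^bsub>E.G\<^esub> inv\<^bsub>E.G\<^esub> y"
    using torsion_central[OF torsion_inv] by (simp add: torsion_closed E.As.inv_mult_group)
  then show ?thesis
    unfolding tors_eq_def using k by (auto intro!: bexI[OF _ torsion_inv])
qed

context
  fixes n :: nat
  assumes type_dvd: "\<And>x y. \<lbrakk>x \<in> Q; y \<in> Q\<rbrakk> \<Longrightarrow> ((\<lambda>z. qop z y) ^^ n) x = x"
begin

text \<open>The quotient \<open>k\<close> of the two generators lies in the kernel and is central.
  As both generators have the same \<open>n\<close>-th power, the \<open>n\<close>-th power of
  \<open>k\<close> is trivial.\<close>

lemma tors_eq_gen: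
  assumes "g \<in> Xt" "h \<in> Xt" "p g = p h"
  shows "tors_eq n (E.gen g) (E.gen h)"
proof -
  define k where "k = E.gen g \<otimes>\<^bsub>E.G\<^esub> inv\<^bsub>E.G\<^esub> (E.gen h)"
  have k: "k \<in> kernel E.G G p_map" "E.gen g = k \<otimes>\<^bsub>E.G\<^esub> E.gen h" "k \<in> carrier E.G"
    using assms by (simp_all add: k_def kernel_def E.As.m_assoc)
  have "E.gen g [^]\<^bsub>E.G\<^esub> n = E.gen h [^]\<^bsub>E.G\<^esub> n"
    using assms by (intro E.gen_pow_const connected_ext E_gen_pow_acts_trivially type_dvd)
  moreover have "E.gen g [^]\<^bsub>E.G\<^esub> n = k [^]\<^bsub>E.G\<^esub> n \<otimes>\<^bsub>E.G\<^esub> E.gen h [^]\<^bsub>E.G\<^esub> n"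
    using E.As.pow_mult_distrib[OF kernel_central[OF k(1)], of "E.gen h" n] k assms by simp
  ultimately have "k [^]\<^bsub>E.G\<^esub> n = \<one>\<^bsub>E.G\<^esub>"
    using k assms by simp
  then show ?thesis
    unfolding tors_eq_def using k assms by (auto simp: torsion_def)
qed

section \<open>A section of the covering, up to torsion\<close>

definition sec :: "'a \<Rightarrow> ('a \<times> bool) list set" where
  "sec y = (SOME g. g \<in> Xt \<and> p g = y)"

lemma sec: "y \<in> Q \<Longrightarrow> sec y \<in> Xt" "y \<in> Q \<Longrightarrow> p (sec y) = y"
proof -
  assume "y \<in> Q"
  then have "\<exists>g. g \<in> Xt \<and> p g = y" using p_surj by metis
  from someI_ex[OF this] show "sec y \<in> Xt" "p (sec y) = y" by (simp_all add: sec_def)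
qed

abbreviation sec_word where "sec_word \<equiv> map (\<lambda>(y, s). (sec y, s))"

lemma sec_word_words [simp]: "w \<in> words Q \<Longrightarrow> sec_word w \<in> words Xt"
  by (induction w) (auto simp: sec)

text \<open>\<open>sec\<close> need not respect the operation, but \<open>sec (qop x y)\<close> and
  \<open>xop (sec x) (sec y)\<close> have the same image under \<open>p\<close>, so
  \<open>tors_eq_gen\<close> applies. Thus \<open>sec\<close> induces a homomorphism from
  \<open>G\<close> to the quotient of \<open>E.G\<close> by \<open>torsion n\<close>.\<close>

lemma tors_eq_sec_word:
  assumes "as_eq Q qop u v"
  shows "tors_eq n (E.cls (sec_word u)) (E.cls (sec_word v))"
  using assms
proof (induction rule: as_eq.induct)
  case (as_refl w)
  then show ?case by (simp add: tors_eq_refl)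
next
  case (as_cancel u v x b)
  then have "E.cls (sec_word (u @ [(x, b), (x, \<not> b)] @ v)) = E.cls (sec_word (u @ v))"
    using as_eq.as_cancel[of "sec_word u" Xt "sec_word v" "sec x" xop b]
    by (simp add: E.cls_eq_iff sec)
  then show ?case using as_cancel by (simp add: tors_eq_refl)
next
  case (as_rel u v x y)
  have "tors_eq n (E.gen (sec (qop x y))) (E.gen (xop (sec x) (sec y)))"
    using as_rel by (intro tors_eq_gen) (auto simp: sec p_xop xop_closed)
  then have "tors_eq n (E.cls (sec_word u) \<otimes>\<^bsub>E.G\<^esub> (E.gen (sec (qop x y)) \<otimes>\<^bsub>E.G\<^esub> E.cls (sec_word v)))
      (E.cls (sec_word u) \<otimes>\<^bsub>E.G\<^esub> (E.gen (xop (sec x) (sec y)) \<otimes>\<^bsub>E.G\<^esub> E.cls (sec_word v)))"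
    using as_rel by (intro tors_eq_mult tors_eq_refl) auto
  then show ?case
    using as_rel by (simp add: E.cls_append E.cls_Cons sec E.gen_op E.As.m_assoc)
qed (blast intro: tors_eq_sym tors_eq_trans)+

text \<open>Letter by letter, since \<open>g\<close> and \<open>sec (p g)\<close> have the same
  image under \<open>p\<close>.\<close>

lemma tors_eq_sec_p_word:
  "w \<in> words Xt \<Longrightarrow> tors_eq n (E.cls w) (E.cls (sec_word (p_word w)))"
proof (induction w)
  case Nil
  then show ?case by (simp add: tors_eq_refl)
next
  case (Cons l w)
  obtain g s where l: "l = (g, s)" by force
  have "tors_eq n (E.gen g) (E.gen (sec (p g)))"
    using Cons.prems l by (intro tors_eq_gen) (auto simp: sec)
  then show ?case
    using Cons l by (cases s) (auto simp: E.cls_Cons sec simp del: map_map intro: tors_eq_mult tors_eq_inv)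
qed

text \<open>A word for \<open>x\<close> is congruent to the lift of its image. That image is trivial
  in \<open>G\<close>, so \<open>x\<close> is congruent to the identity and lies in
  \<open>torsion n\<close>.\<close>

lemma kernel_torsion:
  assumes "x \<in> kernel E.G G p_map"
  shows "x [^]\<^bsub>E.G\<^esub> n = \<one>\<^bsub>E.G\<^esub>"
proof -
  obtain w where w: "w \<in> words Xt" "x = E.cls w"
    using assms by (auto simp: kernel_def E.carrier_As)
  then have "as_eq Q qop (p_word w) []"
    using assms by (simp add: kernel_def p_map_cls one_As cls_eq_iff)
  from tors_eq_trans[OF tors_eq_sec_p_word[OF w(1)] tors_eq_sec_word[OF this]]
  have "tors_eq n x \<one>\<^bsub>E.G\<^esub>"
    by (simp add: w E.one_As)
  then show ?thesis
    by (auto simp: tors_eq_def torsion_def kernel_def)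
qed

lemma HQ_2_ext_torsion:
  assumes "c \<in> carrier (HQ 2 Xt xop)"
  shows "c [^]\<^bsub>HQ 2 Xt xop\<^esub> n = \<one>\<^bsub>HQ 2 Xt xop\<^esub>"
proof -
  obtain f where f: "f \<in> iso (HQ 2 Xt xop) Y.L"
    using Y.HQ_2_iso_loops(2) by (auto simp: is_iso_def)
  interpret f: group_hom "HQ 2 Xt xop" Y.L f
    using f by (intro group_hom.intro group_hom_axioms.intro Y.HQ_2_iso_loops(1) Y.L.is_group)
      (simp add: iso_def)
  have "f c \<in> kernel E.G G p_map"
    using f.hom_closed[OF assms] unfolding Y.carrier_L unfolding loops_eq_kernel .
  then have eq: "f (c [^]\<^bsub>HQ 2 Xt xop\<^esub> n) = f \<one>\<^bsub>HQ 2 Xt xop\<^esub>"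
    using assms kernel_torsion by (simp add: f.hom_nat_pow pow_subgroup_generated)
  have inj: "inj_on f (carrier (HQ 2 Xt xop))"
    using f by (simp add: iso_def bij_betw_def)
  show ?thesis
    by (rule inj_onD[OF inj eq]) (use assms in auto)
qed

end

end

theorem theorem5p4:
  fixes Q :: "'a set" and qop :: "'a \<Rightarrow> 'a \<Rightarrow> 'a" and a :: 'a
  assumes "quandle Q qop" and "quandle_connected Q qop" and "a \<in> Q"
  shows "HQ 2 (ext_carrier Q qop) (ext_op Q qop a)
           \<cong> subgroup_generated (As (ext_carrier Q qop) (ext_op Q qop a))
               (kernel (As (ext_carrier Q qop) (ext_op Q qop a)) (As Q qop) (cover_hom Q qop a))
         \<and> (has_finite_type Q qop \<longrightarrow>
           (\<forall>c\<in>carrier (HQ 2 (ext_carrier Q qop) (ext_op Q qop a)).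
              c [^]\<^bsub>HQ 2 (ext_carrier Q qop) (ext_op Q qop a)\<^esub> quandle_type Q qop
                = \<one>\<^bsub>HQ 2 (ext_carrier Q qop) (ext_op Q qop a)\<^esub>))"
proof -
  interpret connected_quandle Q qop a
    using assms by unfold_locales
  \<comment> \<open>Finite type supplies a common period, so the least one is itself a
    period.\<close>
  have "((\<lambda>z. qop z y) ^^ quandle_type Q qop) x = x"
    if "has_finite_type Q qop" "x \<in> Q" "y \<in> Q" for x y
    using LeastI_ex[OF that(1)[unfolded has_finite_type_def]] that(2,3)
    by (simp add: quandle_type_def)
  then show ?thesis
    using HQ_2_ext_iso HQ_2_ext_torsion by blast
qed

end
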